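(* Assume A1 (the Hessian of $f$ is $L$-Lipschitz) and let $\psi$ be twice differentiable. Run the algorithm Zero-Order CNM with the second-order variant of ZeroOrderCubicSteps (both described in the context) with inputs $x_0\in Q$, $\tau_0>0$, $\epsilon>0$, $m\in\mathbb{N}\setminus\{0\}$. Let $x_{k,\ell}(t)$ be the $t$-th iterate of ZeroOrderCubicSteps in the call made at the $k$-th iteration of Zero-Order CNM in the $\ell$-th inner loop (so $x_{k,\ell}(0)=x_k$). Let $T(\epsilon)\le+\infty$ be the first iteration index such that $$\max\Bigl\{\|\nabla f(x_{T(\epsilon),\ell}(t))+\psi'(x_{T(\epsilon),\ell}(t))\|,\ \frac{1}{2^2 3^3\,m\max\{\tau_0,L\}}\bigl[\xi(x_{T(\epsilon),\ell}(t))\bigr]^2\Bigr\}\le\epsilon$$ for some $\ell\ge0$ and $t\in\{0,\dots,m\}$. Then $$T(\epsilon)\;\le\;\frac{384\cdot2^{5/2}\,(2/3)^{1/6}\,\max\{\tau_0,L\}^{1/2}\,(F(x_0)-F^\star)}{\sqrt m}\,\epsilon^{-3/2},$$ and the total number $\mathrm{ZO}_{T(\epsilon)}$ of function evaluations of $f$ performed during the first $T(\epsilon)$ iterations satisfies $$\mathrm{ZO}_{T(\epsilon)}\;\le\;\mathcal{O}\Bigl(\frac{mn+n^2}{\sqrt m}\max\{\tau_0,L\}^{1/2}(F(x_0)-F^\star)\,\epsilon^{-3/2}+(mn+3n^2)\log_2\frac{\max\{\tau_0,L\}}{\tau_0}\Bigr),$$ with an absolute constant hidden in $\mathcal{O}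(\cdot)$.
   Context: Setting: $\|\cdot\|$ is the Euclidean norm for vectors and the spectral norm for matrices; $e_1,\dots,e_n$ is the standard basis of $\mathbb{R}^n$; $A\succeq0$ means $\langle Av,v\rangle\ge0$ for all $v$; $I$ is the identity matrix. $f:\mathbb{R}^n\to\mathbb{R}$ is twice continuously differentiable (possibly non-convex), $\psi:\mathbb{R}^n\to\mathbb{R}\cup\{+\infty\}$ is proper, closed and convex, $Q=\operatorname{dom}\psi$, $F=f+\psi$, and $F^\star=\inf_{x\in Q}F(x)>-\infty$. Assumption A1: $\|\nabla^2 f(y)-\nabla^2 f(x)\|\le L\|y-x\|$ for all $x,y\in\mathbb{R}^n$, where $L\ge 0$. When $\psi$ is twice differentiable (so that the Hessian of $F$ is well-defined on $Q$, and $\psi'=\nabla\psi$), $\xi(y):=\max\{-\lambda_{\min}(\nabla^2F(y)),0\}$ for $y\in Q$. Second-order variant of the procedure ZeroOrderCubicSteps$(x,B,\sigma,m,\epsilon)$ ($x\in Q$, $B=B^\top\in\mathbb{R}^{n\times n}$, $\sigma>0$, $m\ge1$, $\epsilon>0$): Step 0: set $x_0:=x$, $t:=0$. Step 1: if $t=m$, stop and return $(x_t,\text{success})$. Step 2: with $h_g=\frac{1}{3^{1/3}}\bigl[\frac{\epsilon m}{\sigma n^{1/2}}\bigr]^{1/2}$ compute $g_t\in\mathbb{R}^n$ by $[g_t]^{(i)}=\frac{f(x_t+h_ge_i)-f(x_t-h_ge_i)}{2h_g}$, $i=1,\dots,n$. Step 3: with $M_{x_t,\sigma}(y)=f(x_t)+\langle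 g_t,y-x_t\rangle+\frac12\langle B(y-x_t),y-x_t\rangle+\frac{\sigma}{6}\|y-x_t\|^3$, compute $x_{t+1}\in Q$ as an approximate minimizer of $M_{x_t,\sigma}+\psi$ over $Q$ such that $M_{x_t,\sigma}(x_{t+1})+\psi(x_{t+1})\le F(x_t)$, $\|\nabla M_{x_t,\sigma}(x_{t+1})+\psi'(x_{t+1})\|\le\frac{\sigma}{4}\|x_{t+1}-x_t\|^2$ for some $\psi'(x_{t+1})\in\partial\psi(x_{t+1})$, and $B+\sigma\|x_{t+1}-x_t\|I+\nabla^2\psi(x_{t+1})\succeq0$. Step 4: if $F(x_0)-F(x_{t+1})\ge\frac{\epsilon^{3/2}}{384\,\sigma^{1/2}}(t+1)$, set $t:=t+1$ and go to Step 1; otherwise stop and return $(x_{t+1},\text{halt})$. Algorithm Zero-Order CNM: Step 0: given $x_0\in Q$, $\tau_0>0$, $\epsilon>0$, $m\ge1$, set $k:=0$. Step 1: set $\ell:=0$. Step 1.1: with $\sigma_{k,\ell}=2^4(2/3)^{1/3}(2^\ell\tau_k)m$ and $h_{k,\ell}=\Bigl[\frac{3^4\sigma_{k,\ell}^{3/2}\epsilon^{3/2}}{2^{14}\cdot192\,n^3(2^\ell\tau_k)^3}\Bigr]^{1/3}$, compute $B_{k,\ell}=\frac12(A_{k,\ell}+A_{k,\ell}^\top)$ where, with $h=h_{k,\ell}$, $[A_{k,\ell}]^{(i,j)}=\frac{f(x_k+he_i+he_j)-f(x_k+he_i)-f(x_k+he_j)+f(x_k)}{h^2}$, $i,j=1,\dots,n$.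 Step 1.2: $(\hat x_{k,\ell},\alpha_{k,\ell})=$ ZeroOrderCubicSteps$(x_k,B_{k,\ell},\sigma_{k,\ell},m,\epsilon)$. Step 2: if $\alpha_{k,\ell}=\text{halt}$, set $\ell:=\ell+1$ and go to Step 1.1. Step 3: let $\ell_k$ be the current $\ell$; set $x_{k+1}=\hat x_{k,\ell_k}$, $\tau_{k+1}=\max\{\tau_0,2^{\ell_k-1}\tau_k\}$, $k:=k+1$, and go to Step 1. *)

theory Defs
  imports "HOL-Analysis.Analysis"
begin

section \<open>Gradients, Hessians, eigenvalues\<close>

definition gradient :: "(real^'n \<Rightarrow> real) \<Rightarrow> real^'n \<Rightarrow> real^'n" where
  "gradient f x = (\<chi> i. frechet_derivative f (at x) (axis i 1))"

definition hessian :: "(real^'n \<Rightarrow> real) \<Rightarrow> real^'n \<Rightarrow> real^'n^'n" where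
  "hessian f x = jacobian (gradient f) (at x)"

definition twice_continuously_differentiable :: "(real^'n \<Rightarrow> real) \<Rightarrow> bool" where
  "twice_continuously_differentiable f \<longleftrightarrow>
     (\<forall>x. f differentiable (at x)) \<and> (\<forall>x. gradient f differentiable (at x)) \<and>
     continuous_on UNIV (hessian f)"

definition spectral_norm :: "real^'n^'n \<Rightarrow> real" where
  "spectral_norm A = onorm (\<lambda>v. A *v v)"

definition psd :: "real^'n^'n \<Rightarrow> bool" where
  "psd A \<longleftrightarrow> (\<forall>v. (A *v v) \<bullet> v \<ge> 0)"

text \<open>Used for symmetric matrices only, for which the set of real eigenvalues is finite and nonempty.\<close>

definition lambda_min :: "real^'n^'n \<Rightarrow> real" where
  "lambda_min A = Min {l. \<exists>v. v \<noteq> 0 \<and> A *v v = l *\<^sub>R v}"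


section \<open>Extended-valued functions\<close>

definition edom :: "(real^'n \<Rightarrow> ereal) \<Rightarrow> (real^'n) set" where
  "edom \<psi> = {x. \<psi> x < \<infinity>}"

definition epi :: "(real^'n \<Rightarrow> ereal) \<Rightarrow> ((real^'n) \<times> real) set" where
  "epi \<psi> = {(x, r). \<psi> x \<le> ereal r}"

definition proper_closed_convex :: "(real^'n \<Rightarrow> ereal) \<Rightarrow> bool" where
  "proper_closed_convex \<psi> \<longleftrightarrow>
     (\<forall>x. \<psi> x \<noteq> -\<infinity>) \<and> edom \<psi> \<noteq> {} \<and> closed (epi \<psi>) \<and> convex (epi \<psi>)"

definition subdifferential :: "(real^'n \<Rightarrow> ereal) \<Rightarrow> real^'n \<Rightarrow> (real^'n) set" where
  "subdifferential \<psi> x = {g. \<forall>y. \<psi> x + ereal (g \<bullet> (y - x)) \<le> \<psi> y}"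

definition finite_part :: "(real^'n \<Rightarrow> ereal) \<Rightarrow> real^'n \<Rightarrow> real" where
  "finite_part \<psi> x = real_of_ereal (\<psi> x)"

text \<open>
  Derivatives of an extended-valued function exist only at points around which the function
  is finite. Hence a function that is twice differentiable at every point of its domain has an
  open domain; this is what makes its Hessian well defined throughout the domain and reduces
  its subdifferential there to the gradient.
\<close>

definition twice_differentiable_at :: "(real^'n \<Rightarrow> ereal) \<Rightarrow> real^'n \<Rightarrow> bool" where
  "twice_differentiable_at \<psi> x \<longleftrightarrow>
     x \<in> interior (edom \<psi>) \<and>
     (\<forall>\<^sub>F y in nhds x. finite_part \<psi> differentiable (at y)) \<and>
     gradient (finite_part \<psi>) differentiable (at x)"


section \<open>The composite objective\<close>

definition objective :: "(real^'n \<Rightarrow> real) \<Rightarrow> (real^'n \<Rightarrow> ereal) \<Rightarrow> real^'n \<Rightarrow> ereal" where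
  "objective f \<psi> x = ereal (f x) + \<psi> x"

definition opt_value :: "(real^'n \<Rightarrow> real) \<Rightarrow> (real^'n \<Rightarrow> ereal) \<Rightarrow> ereal" where
  "opt_value f \<psi> = (INF x\<in>edom \<psi>. objective f \<psi> x)"

definition xi :: "(real^'n \<Rightarrow> real) \<Rightarrow> (real^'n \<Rightarrow> ereal) \<Rightarrow> real^'n \<Rightarrow> real" where
  "xi f \<psi> y = max (- lambda_min (hessian (finite_part (objective f \<psi>)) y)) 0"


section \<open>The procedure ZeroOrderCubicSteps, second-order variant\<close>

definition grad_stepsize :: "nat \<Rightarrow> real \<Rightarrow> nat \<Rightarrow> real \<Rightarrow> real" where
  "grad_stepsize n \<sigma> m \<epsilon> = 1 / 3 powr (1/3) * sqrt (\<epsilon> * real m / (\<sigma> * sqrt (real n)))"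

definition fd_gradient :: "(real^'n \<Rightarrow> real) \<Rightarrow> real \<Rightarrow> real^'n \<Rightarrow> real^'n" where
  "fd_gradient f h x = (\<chi> i. (f (x + h *\<^sub>R axis i 1) - f (x - h *\<^sub>R axis i 1)) / (2 * h))"

definition cubic_model ::
  "(real^'n \<Rightarrow> real) \<Rightarrow> real^'n \<Rightarrow> real^'n^'n \<Rightarrow> real \<Rightarrow> real^'n \<Rightarrow> real^'n \<Rightarrow> real" where
  "cubic_model f g B \<sigma> x y =
     f x + g \<bullet> (y - x) + 1/2 * ((B *v (y - x)) \<bullet> (y - x)) + \<sigma> / 6 * norm (y - x) ^ 3"

definition approx_cubic_step ::
  "(real^'n \<Rightarrow> real) \<Rightarrow> (real^'n \<Rightarrow> ereal) \<Rightarrow> real^'n \<Rightarrow> real^'n^'n \<Rightarrow> real \<Rightarrow> real^'n \<Rightarrow> real^'n \<Rightarrow> bool"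
where
  "approx_cubic_step f \<psi> g B \<sigma> x y \<longleftrightarrow>
     y \<in> edom \<psi> \<and>
     ereal (cubic_model f g B \<sigma> x y) + \<psi> y \<le> objective f \<psi> x \<and>
     (\<exists>p\<in>subdifferential \<psi> y.
        norm (gradient (cubic_model f g B \<sigma> x) y + p) \<le> \<sigma> / 4 * (norm (y - x))\<^sup>2) \<and>
     psd (B + (\<sigma> * norm (y - x)) *\<^sub>R mat 1 + hessian (finite_part \<psi>) y)"

datatype outcome = Success | Halt

text \<open>
  An execution of the procedure is given by its iterates \<open>y 0, \<dots>, y N\<close> (values of \<open>y\<close> beyond
  \<open>N\<close> are irrelevant) and its outcome. It is a relation because the approximate minimizers are
  not unique. In both outcomes the returned point is \<open>y N\<close>: on success \<open>N = m\<close>; on halt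
  \<open>N = t + 1\<close>, where \<open>t\<close> is the index at which the decrease test failed, so that the rejected
  point is the last iterate.
\<close>

definition sufficient_decrease ::
  "(real^'n \<Rightarrow> real) \<Rightarrow> (real^'n \<Rightarrow> ereal) \<Rightarrow> real \<Rightarrow> real \<Rightarrow> (nat \<Rightarrow> real^'n) \<Rightarrow> nat \<Rightarrow> bool" where
  "sufficient_decrease f \<psi> \<sigma> \<epsilon> y t \<longleftrightarrow>
     objective f \<psi> (y 0) - objective f \<psi> (y (t + 1)) \<ge>
       ereal (\<epsilon> powr (3/2) / (384 * sqrt \<sigma>) * real (t + 1))"

definition zero_order_cubic_steps ::
  "(real^'n \<Rightarrow> real) \<Rightarrow> (real^'n \<Rightarrow> ereal) \<Rightarrow> real^'n \<Rightarrow> real^'n^'n \<Rightarrow> real \<Rightarrow> nat \<Rightarrow> real \<Rightarrow>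
    (nat \<Rightarrow> real^'n) \<Rightarrow> nat \<Rightarrow> outcome \<Rightarrow> bool" where
  "zero_order_cubic_steps f \<psi> x B \<sigma> m \<epsilon> y N \<alpha> \<longleftrightarrow>
     y 0 = x \<and> N \<le> m \<and>
     (\<forall>t<N. approx_cubic_step f \<psi> (fd_gradient f (grad_stepsize CARD('n) \<sigma> m \<epsilon>) (y t))
              B \<sigma> (y t) (y (t + 1))) \<and>
     (case \<alpha> of
        Success \<Rightarrow> N = m \<and> (\<forall>t<m. sufficient_decrease f \<psi> \<sigma> \<epsilon> y t)
      | Halt \<Rightarrow> (\<exists>t. N = t + 1 \<and> (\<forall>s<t. sufficient_decrease f \<psi> \<sigma> \<epsilon> y s) \<and>
                  \<not> sufficient_decrease f \<psi> \<sigma> \<epsilon> y t))"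


section \<open>The algorithm Zero-Order CNM\<close>

definition reg_param :: "nat \<Rightarrow> real \<Rightarrow> nat \<Rightarrow> real" where
  "reg_param m \<tau> l = 2 ^ 4 * (2/3) powr (1/3) * (2 ^ l * \<tau>) * real m"

definition hess_stepsize :: "nat \<Rightarrow> nat \<Rightarrow> real \<Rightarrow> real \<Rightarrow> nat \<Rightarrow> real" where
  "hess_stepsize n m \<epsilon> \<tau> l =
     (3 ^ 4 * reg_param m \<tau> l powr (3/2) * \<epsilon> powr (3/2) /
        (2 ^ 14 * 192 * real n ^ 3 * (2 ^ l * \<tau>) ^ 3)) powr (1/3)"

definition fd_matrix :: "(real^'n \<Rightarrow> real) \<Rightarrow> real \<Rightarrow> real^'n \<Rightarrow> real^'n^'n" where
  "fd_matrix f h x = (\<chi> i j.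
     (f (x + h *\<^sub>R axis i 1 + h *\<^sub>R axis j 1) - f (x + h *\<^sub>R axis i 1)
        - f (x + h *\<^sub>R axis j 1) + f x) / h\<^sup>2)"

definition fd_hessian :: "(real^'n \<Rightarrow> real) \<Rightarrow> real \<Rightarrow> real^'n \<Rightarrow> real^'n^'n" where
  "fd_hessian f h x = (1/2) *\<^sub>R (fd_matrix f h x + transpose (fd_matrix f h x))"

text \<open>
  One call of the procedure, made at outer iteration \<open>k = outer_index\<close> in inner loop
  \<open>l = inner_index\<close>, with \<open>x_k = base_point\<close> and \<open>\<tau>_k = tau\<close>. Its iterates \<open>x_{k,l}(t)\<close> are
  \<open>iterates t\<close> for \<open>t \<le> num_steps\<close>.
\<close>

record ('n::finite) call =
  outer_index :: nat
  inner_index :: nat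
  base_point :: "real^'n"
  tau :: real
  iterates :: "nat \<Rightarrow> real^'n"
  num_steps :: nat
  result :: outcome

text \<open>
  The algorithm has no stopping rule and each call of the procedure takes at most \<open>m\<close> steps,
  so a run is an infinite sequence of calls. Nothing is presupposed about the inner loop:
  a run may stay forever in one outer iteration, with every call halting.
\<close>

definition zero_order_CNM ::
  "(real^'n \<Rightarrow> real) \<Rightarrow> (real^'n \<Rightarrow> ereal) \<Rightarrow> real^'n \<Rightarrow> real \<Rightarrow> real \<Rightarrow> nat \<Rightarrow> (nat \<Rightarrow> 'n call) \<Rightarrow> bool"
where
  "zero_order_CNM f \<psi> x0 \<tau>0 \<epsilon> m run \<longleftrightarrow>
     outer_index (run 0) = 0 \<and> inner_index (run 0) = 0 \<and>
     base_point (run 0) = x0 \<and> tau (run 0) = \<tau>0 \<and>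
     (\<forall>c. let l = inner_index (run c); x = base_point (run c); \<tau> = tau (run c) in
        zero_order_cubic_steps f \<psi> x (fd_hessian f (hess_stepsize CARD('n) m \<epsilon> \<tau> l) x)
          (reg_param m \<tau> l) m \<epsilon> (iterates (run c)) (num_steps (run c)) (result (run c)) \<and>
        (case result (run c) of
           Halt \<Rightarrow>
             outer_index (run (c + 1)) = outer_index (run c) \<and>
             inner_index (run (c + 1)) = l + 1 \<and>
             base_point (run (c + 1)) = x \<and>
             tau (run (c + 1)) = \<tau>
         | Success \<Rightarrow>
             outer_index (run (c + 1)) = outer_index (run c) + 1 \<and>
             inner_index (run (c + 1)) = 0 \<and>
             base_point (run (c + 1)) = iterates (run c) (num_steps (run c)) \<and>
             tau (run (c + 1)) = max \<tau>0 (2 powr (real l - 1) * \<tau>)))"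

definition approx_second_order_point ::
  "(real^'n \<Rightarrow> real) \<Rightarrow> (real^'n \<Rightarrow> ereal) \<Rightarrow> real \<Rightarrow> real \<Rightarrow> real \<Rightarrow> nat \<Rightarrow> real^'n \<Rightarrow> bool" where
  "approx_second_order_point f \<psi> L \<tau>0 \<epsilon> m y \<longleftrightarrow>
     max (norm (gradient f y + gradient (finite_part \<psi>) y))
         (1 / (2\<^sup>2 * 3 ^ 3 * real m * max \<tau>0 L) * (xi f \<psi> y)\<^sup>2) \<le> \<epsilon>"

text \<open>The first outer iteration that produces such a point; \<open>\<infinity>\<close> if there is none.\<close>

definition hitting_iteration ::
  "(real^'n \<Rightarrow> real) \<Rightarrow> (real^'n \<Rightarrow> ereal) \<Rightarrow> real \<Rightarrow> real \<Rightarrow> real \<Rightarrow> nat \<Rightarrow> (nat \<Rightarrow> 'n call) \<Rightarrow> enat"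
where
  "hitting_iteration f \<psi> L \<tau>0 \<epsilon> m run =
     Inf {enat k | k. \<exists>c t. outer_index (run c) = k \<and> t \<le> num_steps (run c) \<and>
            approx_second_order_point f \<psi> L \<tau>0 \<epsilon> m (iterates (run c) t)}"

text \<open>
  Every occurrence of \<open>f\<close> in the formulas counts as an evaluation and no value is reused:
  four for each of the \<open>n\<^sup>2\<close> entries of the difference matrix and, for each step of the procedure,
  two for each of the \<open>n\<close> entries of the difference gradient plus four for the values \<open>f(x_t)\<close>
  (in the model), \<open>F(x_t)\<close>, \<open>F(x_0)\<close> and \<open>F(x_{t+1})\<close>.
\<close>

definition call_evaluations :: "('n::finite) call \<Rightarrow> nat" where
  "call_evaluations c = 4 * CARD('n)\<^sup>2 + num_steps c * (2 * CARD('n) + 4)"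

text \<open>
  Evaluations in the outer iterations \<open>0, \<dots>, T - 1\<close>. The sum is a series of extended reals, so it
  is \<open>\<infinity>\<close> if infinitely many calls are made in these iterations.
\<close>

definition evaluations_before :: "enat \<Rightarrow> (nat \<Rightarrow> ('n::finite) call) \<Rightarrow> ereal" where
  "evaluations_before T run =
     (\<Sum>c. if enat (outer_index (run c)) < T then ereal (real (call_evaluations (run c))) else 0)"

text \<open>
  The absolute constant of the evaluation bound. As the dimension is a type, an existential
  quantifier over the constant inside the theorem would let it depend on the dimension; a fixed
  number does not.
\<close>

definition evaluation_constant :: real where
  "evaluation_constant = 2 ^ 15"

end

theory Submission
  imports Defs
begin

text \<open>
  Within one call put \<open>q = sqrt (\<epsilon> / \<sigma>)\<close>. The step sizes make the error of the difference
  gradient at most \<open>\<sigma> q\<^sup>2 / 150\<close> and that of the difference Hessian at most \<open>\<sigma> q / 19\<close>, and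
  \<open>L \<le> 2\<^sup>l \<tau>\<close> gives \<open>L m \<le> \<sigma> / 13\<close>. Let \<open>r\<^sub>s\<close> be the step lengths and \<open>v\<^sub>s\<close> the
  distance travelled up to step \<open>s\<close> divided by \<open>m\<close>; it controls the error of keeping the Hessian
  of the first iterate. If the new iterate is not an approximate second-order point, then the
  step decreases the objective by at least \<open>\<sigma> (q\<^sup>3 / 384 + (r\<^sub>s\<^sup>3 - v\<^sub>s\<^sup>3) / 50)\<close>, and
  by the power mean inequality the cubic terms sum up to something nonnegative. Hence a call without a hit
  and with \<open>L \<le> 2\<^sup>l \<tau>\<close> never halts, so before the first hit \<open>2\<^sup>l \<tau>\<close> stays at most \<open>2 max \<tau>\<^sub>0 L\<close>, and each outer
  iteration decreases the objective by a fixed amount. Since \<open>\<tau>\<^sub>k\<^sub>+\<^sub>1 \<ge> 2\<^bsup>l-1\<^esup> \<tau>\<^sub>k\<close>, the number of calls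
  telescopes to at most \<open>2 T + log\<^sub>2 (max \<tau>\<^sub>0 L / \<tau>\<^sub>0)\<close>.
\<close>

section \<open>Gradients and Hessians\<close>

lemma has_derivative_gradient:
  fixes f :: "real^'n \<Rightarrow> real"
  assumes "f differentiable (at x)"
  shows "(f has_derivative (\<lambda>d. gradient f x \<bullet> d)) (at x)"
proof -
  let ?f' = "frechet_derivative f (at x)"
  have der: "(f has_derivative ?f') (at x)"
    using assms frechet_derivative_works by blast
  then have "linear ?f'" by (rule has_derivative_linear)
  moreover have "linear (\<lambda>d. gradient f x \<bullet> d)"
    by (simp add: bounded_linear.linear bounded_linear_inner_right)
  ultimately have "?f' = (\<lambda>d. gradient f x \<bullet> d)"
  proof (rule linear_eq_stdbasis)
    fix b :: "real^'n" assume "b \<in> Basis"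
    then obtain i where "b = axis i 1" by (auto simp: Basis_vec_def)
    then show "?f' b = gradient f x \<bullet> b"
      by (simp add: gradient_def inner_axis)
  qed
  then show ?thesis using der by simp
qed

lemma gradient_eqI:
  fixes f :: "real^'n \<Rightarrow> real"
  assumes "(f has_derivative (\<lambda>d. g \<bullet> d)) (at x)"
  shows "gradient f x = g"
proof -
  have "frechet_derivative f (at x) = (\<lambda>d. g \<bullet> d)"
    using assms frechet_derivative_at by force
  then show ?thesis by (simp add: gradient_def vec_eq_iff inner_axis)
qed

lemma gradient_add:
  fixes f g :: "real^'n \<Rightarrow> real"
  assumes "f differentiable (at x)" "g differentiable (at x)"
  shows "gradient (\<lambda>z. f z + g z) x = gradient f x + gradient g x"
  by (rule gradient_eqI)
    (use has_derivative_add[OF has_derivative_gradient[OF assms(1)] has_derivative_gradient[OF assms(2)]]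
      in \<open>simp add: inner_add_left\<close>)

lemma has_derivative_hessian:
  fixes f :: "real^'n \<Rightarrow> real"
  assumes "gradient f differentiable (at x)"
  shows "(gradient f has_derivative (\<lambda>d. hessian f x *v d)) (at x)"
  using assms unfolding hessian_def by (simp add: jacobian_works)

lemma hessian_eqI:
  fixes f :: "real^'n \<Rightarrow> real"
  assumes "(gradient f has_derivative (\<lambda>d. H *v d)) (at x)"
  shows "hessian f x = H"
proof -
  have "frechet_derivative (gradient f) (at x) = (\<lambda>d. H *v d)"
    using assms frechet_derivative_at by force
  then show ?thesis by (simp add: hessian_def jacobian_def)
qed

lemma gradient_transform_eventually:
  fixes f g :: "real^'n \<Rightarrow> real"
  assumes "\<forall>\<^sub>F z in nhds x. f z = g z" "g differentiable (at x)"
  shows "gradient f x = gradient g x"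
proof (rule gradient_eqI)
  show "(f has_derivative (\<lambda>d. gradient g x \<bullet> d)) (at x)"
    using has_derivative_gradient[OF assms(2)]
  proof (rule has_derivative_transform_eventually)
    show "\<forall>\<^sub>F z in at x. g z = f z"
      unfolding eventually_at_filter using assms(1) by (rule eventually_mono) simp
    show "g x = f x" using eventually_nhds_x_imp_x[OF assms(1)] by simp
  qed simp
qed

lemma has_real_derivative_along_line:
  fixes f :: "real^'n \<Rightarrow> real"
  assumes "f differentiable (at (x + t *\<^sub>R d))"
  shows "((\<lambda>t. f (x + t *\<^sub>R d)) has_real_derivative gradient f (x + t *\<^sub>R d) \<bullet> d) (at t)"
proof -
  have "((\<lambda>t. x + t *\<^sub>R d) has_derivative (\<lambda>s. s *\<^sub>R d)) (at t)"
    by (auto intro!: derivative_eq_intros)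
  from has_derivative_compose[OF this has_derivative_gradient[OF assms]]
  show ?thesis by (simp add: has_field_derivative_def mult_commute_abs)
qed

text \<open>
  The second difference on the left is symmetric in \<open>u\<close> and \<open>v\<close>, which yields the symmetry of the
  Hessian even where the gradient is differentiable only at the single point \<open>x\<close>.
\<close>

lemma second_difference_approx:
  fixes f :: "real^'n \<Rightarrow> real"
  assumes "\<forall>\<^sub>F y in nhds x. f differentiable (at y)"
    and "gradient f differentiable (at x)" and "e > 0"
  shows "\<forall>\<^sub>F t in at_right 0.
    \<bar>f (x + t *\<^sub>R u + t *\<^sub>R v) - f (x + t *\<^sub>R u) - f (x + t *\<^sub>R v) + f x
       - t\<^sup>2 * ((hessian f x *v v) \<bullet> u)\<bar> \<le> e * t\<^sup>2"
proof -
  define c where "c = norm u + norm v + 1"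
  have c: "c > 0" "norm u \<le> c" "norm v \<le> c" "norm u + norm v \<le> c"
    using norm_ge_zero[of u] norm_ge_zero[of v] unfolding c_def by linarith+
  \<comment> \<open>Chosen so that the final estimate \<open>2 * e' * t^2 * c^2\<close> equals
    \<open>e * t^2\<close>.\<close>
  define e' where "e' = e / (2 * c\<^sup>2)"
  have e': "e' > 0" using assms(3) c by (simp add: e'_def)
  obtain d1 where d1: "d1 > 0" "\<And>y. dist y x < d1 \<Longrightarrow> f differentiable (at y)"
    using assms(1) unfolding eventually_nhds_metric by blast
  obtain d2 where d2: "d2 > 0" "\<And>y. norm (y - x) < d2 \<Longrightarrow>
      norm (gradient f y - gradient f x - hessian f x *v (y - x)) \<le> e' * norm (y - x)"
    using has_derivative_hessian[OF assms(2)] e' unfolding has_derivative_at_alt by blast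
  define d where "d = min d1 d2 / c"
  have "d > 0" using d1 d2 c by (simp add: d_def)
  show ?thesis
  proof (rule eventually_at_rightI[OF _ \<open>d > 0\<close>])
    fix t assume "t \<in> {0<..<d}"
    then have t: "0 < t" "t * c < min d1 d2"
      using c by (auto simp: d_def pos_less_divide_eq)
    have near: "norm (s *\<^sub>R u + r *\<^sub>R v) \<le> t * c"
      if "0 \<le> s" "s \<le> t" "0 \<le> r" "r \<le> t" for s r
    proof -
      have "norm (s *\<^sub>R u + r *\<^sub>R v) \<le> s * norm u + r * norm v"
        using norm_triangle_ineq[of "s *\<^sub>R u" "r *\<^sub>R v"] that by simp
      also have "\<dots> \<le> t * norm u + t * norm v"
        using that by (intro add_mono mult_right_mono) auto
      also have "\<dots> \<le> t * c" using c t by (simp flip: distrib_left)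
      finally show ?thesis .
    qed
    have diff: "f differentiable (at (x + s *\<^sub>R u + r *\<^sub>R v))"
      if "0 \<le> s" "s \<le> t" "0 \<le> r" "r \<le> t" for s r
      by (rule d1(2)) (use near[OF that] t in \<open>simp add: dist_norm add.assoc\<close>)
    have grad: "norm (gradient f (x + s *\<^sub>R u + r *\<^sub>R v) - gradient f x
        - hessian f x *v (s *\<^sub>R u + r *\<^sub>R v)) \<le> e' * (t * c)"
      if "0 \<le> s" "s \<le> t" "0 \<le> r" "r \<le> t" for s r
    proof -
      have "norm (gradient f (x + s *\<^sub>R u + r *\<^sub>R v) - gradient f x
        - hessian f x *v (s *\<^sub>R u + r *\<^sub>R v)) \<le> e' * norm (s *\<^sub>R u + r *\<^sub>R v)"
        using d2(2)[of "x + s *\<^sub>R u + r *\<^sub>R v"] near[OF that] t by (simp add: add.assoc)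
      also have "\<dots> \<le> e' * (t * c)"
        using near[OF that] e' by (intro mult_left_mono) auto
      finally show ?thesis .
    qed
    \<comment> \<open>The second difference is the increment of \<open>\<phi>\<close> over
      \<open>[0, t]\<close>. One mean value step in the direction \<open>u\<close> turns it into a
      difference of two gradients, each of which is then expanded to first order at
      \<open>x\<close>.\<close>
    define \<phi> where "\<phi> s = f (x + t *\<^sub>R v + s *\<^sub>R u) - f (x + s *\<^sub>R u)" for s
    have "\<exists>s>0. s < t \<and> \<phi> t - \<phi> 0 =
        (t - 0) * (gradient f (x + t *\<^sub>R v + s *\<^sub>R u) \<bullet> u - gradient f (x + s *\<^sub>R u) \<bullet> u)"
    proof (rule MVT2[OF t(1)])
      fix s assume s: "0 \<le> s" "s \<le> t"
      show "(\<phi> has_real_derivative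
        gradient f (x + t *\<^sub>R v + s *\<^sub>R u) \<bullet> u - gradient f (x + s *\<^sub>R u) \<bullet> u) (at s)"
        unfolding \<phi>_def
        by (intro DERIV_diff has_real_derivative_along_line)
          (use diff[of s t] diff[of s 0] s t in \<open>simp_all add: ac_simps\<close>)
    qed
    then obtain s where s: "0 < s" "s < t" "\<phi> t - \<phi> 0 =
        t * ((gradient f (x + t *\<^sub>R v + s *\<^sub>R u) - gradient f (x + s *\<^sub>R u)) \<bullet> u)"
      by (auto simp: inner_diff_left)
    \<comment> \<open>In \<open>w1 - w0\<close> the terms coming from \<open>s *\<^sub>R u\<close>
      and from the gradient at \<open>x\<close> cancel, so only the part of the Hessian along
      \<open>v\<close> survives.\<close>
    define w where "w = gradient f (x + t *\<^sub>R v + s *\<^sub>R u) - gradient f (x + s *\<^sub>R u) - t *\<^sub>R (hessian f x *v v)"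
    define w1 where "w1 = gradient f (x + s *\<^sub>R u + t *\<^sub>R v) - gradient f x
        - hessian f x *v (s *\<^sub>R u + t *\<^sub>R v)"
    define w0 where "w0 = gradient f (x + s *\<^sub>R u + 0 *\<^sub>R v) - gradient f x
        - hessian f x *v (s *\<^sub>R u + 0 *\<^sub>R v)"
    have "norm w1 \<le> e' * (t * c)" "norm w0 \<le> e' * (t * c)"
      unfolding w1_def w0_def by (intro grad; use s t in simp)+
    moreover have "w = w1 - w0"
      by (simp add: w_def w1_def w0_def matrix_vector_right_distrib matrix_vector_mult_scaleR ac_simps)
    ultimately have w: "norm w \<le> 2 * e' * (t * c)"
      using norm_triangle_ineq4[of w1 w0] by simp
    have "f (x + t *\<^sub>R u + t *\<^sub>R v) - f (x + t *\<^sub>R u) - f (x + t *\<^sub>R v) + f x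
       - t\<^sup>2 * ((hessian f x *v v) \<bullet> u) = \<phi> t - \<phi> 0 - t\<^sup>2 * ((hessian f x *v v) \<bullet> u)"
      by (simp add: \<phi>_def ac_simps)
    also have "\<dots> = t * (w \<bullet> u)"
      unfolding s(3) w_def by (simp add: inner_diff_left power2_eq_square algebra_simps)
    finally have "\<bar>f (x + t *\<^sub>R u + t *\<^sub>R v) - f (x + t *\<^sub>R u) - f (x + t *\<^sub>R v) + f x
       - t\<^sup>2 * ((hessian f x *v v) \<bullet> u)\<bar> = t * \<bar>w \<bullet> u\<bar>"
      using t by (simp add: abs_mult)
    also have "\<dots> \<le> t * (norm w * norm u)"
      using t by (intro mult_left_mono Cauchy_Schwarz_ineq2) auto
    also have "\<dots> \<le> t * (2 * e' * (t * c) * c)"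
      using t w c e' by (intro mult_left_mono mult_mono) auto
    also have "\<dots> = e * t\<^sup>2"
      using c by (simp add: e'_def power2_eq_square field_simps)
    finally show "\<bar>f (x + t *\<^sub>R u + t *\<^sub>R v) - f (x + t *\<^sub>R u) - f (x + t *\<^sub>R v) + f x
       - t\<^sup>2 * ((hessian f x *v v) \<bullet> u)\<bar> \<le> e * t\<^sup>2" .
  qed
qed

lemma hessian_self_adjoint:
  fixes f :: "real^'n \<Rightarrow> real"
  assumes "\<forall>\<^sub>F y in nhds x. f differentiable (at y)"
    and "gradient f differentiable (at x)"
  shows "(hessian f x *v u) \<bullet> v = (hessian f x *v v) \<bullet> u"
proof -
  let ?a = "(hessian f x *v u) \<bullet> v" and ?b = "(hessian f x *v v) \<bullet> u"
  have "\<bar>?a - ?b\<bar> \<le> e" if "e > 0" for e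
  proof -
    have e2: "e / 2 > 0" using that by simp
    have "\<forall>\<^sub>F t :: real in at_right 0. t > 0"
      by (simp add: eventually_at_right_less)
    with second_difference_approx[OF assms e2, of u v] second_difference_approx[OF assms e2, of v u]
    have "\<forall>\<^sub>F t in at_right 0. t > 0 \<and> t\<^sup>2 * \<bar>?a - ?b\<bar> \<le> t\<^sup>2 * e"
    proof eventually_elim
      case (elim t)
      let ?D = "f (x + t *\<^sub>R u + t *\<^sub>R v) - f (x + t *\<^sub>R u) - f (x + t *\<^sub>R v) + f x"
      have 1: "\<bar>?D - t\<^sup>2 * ?b\<bar> \<le> e / 2 * t\<^sup>2" using elim(1) .
      have "f (x + t *\<^sub>R v + t *\<^sub>R u) - f (x + t *\<^sub>R v) - f (x + t *\<^sub>R u) + f x = ?D"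
        by (simp add: ac_simps)
      with elim(2) have 2: "\<bar>?D - t\<^sup>2 * ?a\<bar> \<le> e / 2 * t\<^sup>2" by simp
      from 1 2 have "\<bar>t\<^sup>2 * ?a - t\<^sup>2 * ?b\<bar> \<le> e * t\<^sup>2" by linarith
      then have "t\<^sup>2 * \<bar>?a - ?b\<bar> \<le> t\<^sup>2 * e"
        by (simp add: abs_mult mult.commute flip: right_diff_distrib)
      with elim(3) show ?case by simp
    qed
    from eventually_happens'[OF _ this]
    obtain t :: real where "t > 0" "t\<^sup>2 * \<bar>?a - ?b\<bar> \<le> t\<^sup>2 * e"
      by auto
    then show ?thesis by (simp add: mult_le_cancel_left_pos)
  qed
  then have "\<bar>?a - ?b\<bar> \<le> 0" by (rule field_le_epsilon[of _ 0, simplified])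
  then show ?thesis by simp
qed

section \<open>Eigenvalues and matrix norms\<close>

lemma self_adjoint_eigenvectors_orthogonal:
  fixes A :: "real^'n^'n"
  assumes "\<And>u v. (A *v u) \<bullet> v = (A *v v) \<bullet> u"
    and "A *v u = a *\<^sub>R u" "A *v v = b *\<^sub>R v" "a \<noteq> b"
  shows "orthogonal u v"
proof -
  have "a * (u \<bullet> v) = b * (u \<bullet> v)"
    using assms(1)[of u v] assms(2,3) by (simp add: inner_commute)
  with assms(4) show ?thesis by (simp add: orthogonal_def)
qed

text \<open>One eigenvector per eigenvalue gives nonzero, pairwise orthogonal and hence independent
  vectors, of which there are finitely many. Together with the existence of an eigenvalue this makes
  the \<open>Min\<close> in \<open>lambda_min\<close> meaningful.\<close>

lemma finite_self_adjoint_eigenvalues: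
  fixes A :: "real^'n^'n"
  assumes "\<And>u v. (A *v u) \<bullet> v = (A *v v) \<bullet> u"
  shows "finite {l. \<exists>v. v \<noteq> 0 \<and> A *v v = l *\<^sub>R v}"
proof -
  define E where "E = {l. \<exists>v. v \<noteq> 0 \<and> A *v v = l *\<^sub>R v}"
  define w where "w l = (SOME v. v \<noteq> 0 \<and> A *v v = l *\<^sub>R v)" for l
  have w: "w l \<noteq> 0" "A *v w l = l *\<^sub>R w l" if "l \<in> E" for l
  proof -
    have "\<exists>v. v \<noteq> 0 \<and> A *v v = l *\<^sub>R v" using that by (simp add: E_def)
    from someI_ex[OF this] show "w l \<noteq> 0" "A *v w l = l *\<^sub>R w l" by (simp_all add: w_def)
  qed
  have inj: "inj_on w E"
  proof (rule inj_onI)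
    fix a b assume ab: "a \<in> E" "b \<in> E" and eq: "w a = w b"
    have "a *\<^sub>R w a = b *\<^sub>R w a"
      using w(2)[OF ab(1)] w(2)[OF ab(2)] unfolding eq by metis
    then show "a = b" using w(1)[OF ab(1)] by simp
  qed
  have "pairwise orthogonal (w ` E)"
    unfolding pairwise_image
    by (intro pairwiseI impI)
      (use self_adjoint_eigenvectors_orthogonal[OF assms] w in metis)
  moreover have "0 \<notin> w ` E"
    using w(1) by auto
  ultimately have "finite (w ` E)"
    using pairwise_orthogonal_independent independent_imp_finite by metis
  then have "finite E" using inj by (rule finite_imageD)
  then show ?thesis by (simp add: E_def)
qed

text \<open>A minimizer \<open>v\<close> of the quadratic form on the unit sphere is an eigenvector:
  with \<open>l\<close> the minimum, \<open>Q = A - l I\<close> is positive semidefinite and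
  \<open>Q v \<bullet> v = 0\<close>, and moving \<open>v\<close> along \<open>Q v\<close> would
  make the form of \<open>Q\<close> negative unless \<open>Q v = 0\<close>.\<close>

lemma self_adjoint_has_eigenvalue:
  fixes A :: "real^'n^'n"
  assumes sym: "\<And>u v. (A *v u) \<bullet> v = (A *v v) \<bullet> u"
  shows "\<exists>l v. v \<noteq> 0 \<and> A *v v = l *\<^sub>R v"
proof -
  have "compact (sphere (0::real^'n) 1)" "sphere (0::real^'n) 1 \<noteq> {}"
    by (auto simp: sphere_eq_empty)
  moreover have "continuous_on (sphere 0 1) (\<lambda>v. (A *v v) \<bullet> v)"
    by (intro continuous_intros linear_continuous_on) simp
  ultimately obtain v where v: "norm v = 1"
    and vmin: "\<And>w. norm w = 1 \<Longrightarrow> (A *v v) \<bullet> v \<le> (A *v w) \<bullet> w"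
    using continuous_attains_inf[of "sphere 0 1" "\<lambda>v. (A *v v) \<bullet> v"] by auto
  define l where "l = (A *v v) \<bullet> v"
  define Q where "Q u = A *v u - l *\<^sub>R u" for u
  have Qv: "Q v \<bullet> v = 0"
    using v by (simp add: Q_def l_def inner_diff_left flip: power2_norm_eq_inner)
  have psd: "Q w \<bullet> w \<ge> 0" for w
  proof (cases "w = 0")
    case False
    have "l \<le> (A *v (w /\<^sub>R norm w)) \<bullet> (w /\<^sub>R norm w)"
      unfolding l_def by (rule vmin) (use False in simp)
    also have "\<dots> = ((A *v w) \<bullet> w) / (norm w)\<^sup>2"
      by (simp add: matrix_vector_mult_scaleR power2_eq_square divide_inverse)
    finally show ?thesis
      using False by (simp add: Q_def inner_diff_left pos_le_divide_eq flip: power2_norm_eq_inner)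
  qed (simp add: Q_def)
  define z where "z = Q v"
  have expand: "Q (v + t *\<^sub>R z) \<bullet> (v + t *\<^sub>R z) = 2 * t * (z \<bullet> z) + t\<^sup>2 * (Q z \<bullet> z)" for t
  proof -
    have "Q z \<bullet> v = Q v \<bullet> z"
      using sym[of z v] by (simp add: Q_def inner_diff_left inner_commute[of z v])
    then have "Q z \<bullet> v = z \<bullet> z" by (simp only: z_def)
    moreover have "Q (v + t *\<^sub>R z) = Q v + t *\<^sub>R Q z"
      unfolding Q_def
      by (simp add: matrix_vector_right_distrib matrix_vector_mult_scaleR algebra_simps)
    ultimately show ?thesis
      using Qv by (simp add: inner_add_left inner_add_right power2_eq_square inner_commute[of z v] z_def[symmetric] algebra_simps)
  qed
  have "z \<bullet> z = 0"
  proof (rule ccontr)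
    assume "z \<bullet> z \<noteq> 0"
    then have pos: "z \<bullet> z > 0" by (metis inner_eq_zero_iff inner_gt_zero_iff)
    define c where "c = Q z \<bullet> z"
    have c: "c \<ge> 0" using psd c_def by simp
    \<comment> \<open>Negative, so that the linear term of \<open>expand\<close> decreases the form,
      and small enough that \<open>t * c\<close> uses up at most half of
      \<open>2 * (z \<bullet> z)\<close>.\<close>
    define t where "t = - (z \<bullet> z) / (c + 1)"
    have "t < 0" using pos c by (simp add: t_def)
    moreover have "2 * (z \<bullet> z) + t * c > 0"
    proof -
      have "- t * c \<le> z \<bullet> z"
        using pos c by (simp add: t_def field_simps)
      with pos show ?thesis by linarith
    qed
    ultimately have "t * (2 * (z \<bullet> z) + t * c) < 0" by (rule mult_neg_pos)
    moreover have "t * (2 * (z \<bullet> z) + t * c) \<ge> 0"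
      using psd[of "v + t *\<^sub>R z"] unfolding expand c_def[symmetric]
      by (simp add: power2_eq_square algebra_simps)
    ultimately show False by simp
  qed
  then have "A *v v = l *\<^sub>R v" by (simp add: z_def Q_def)
  moreover have "v \<noteq> 0" using v by auto
  ultimately show ?thesis by blast
qed

lemma lambda_min_eigenvector:
  fixes A :: "real^'n^'n"
  assumes "\<And>u v. (A *v u) \<bullet> v = (A *v v) \<bullet> u"
  obtains v where "v \<noteq> 0" "A *v v = lambda_min A *\<^sub>R v"
proof -
  have "lambda_min A \<in> {l. \<exists>v. v \<noteq> 0 \<and> A *v v = l *\<^sub>R v}"
    unfolding lambda_min_def
    by (rule Min_in) (use finite_self_adjoint_eigenvalues[OF assms] self_adjoint_has_eigenvalue[OF assms] in auto)
  then show ?thesis using that by blast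
qed

section \<open>Norms of matrix-vector products\<close>

lemma norm_matrix_vector_le_spectral_norm:
  fixes A :: "real^'n^'n"
  shows "norm (A *v v) \<le> spectral_norm A * norm v"
  unfolding spectral_norm_def by (rule onorm) simp

lemma norm_le_sqrt_card:
  fixes x :: "real^'n"
  assumes "\<And>i. \<bar>x $ i\<bar> \<le> b"
  shows "norm x \<le> sqrt (real CARD('n)) * b"
proof -
  have b: "b \<ge> 0" using assms[of undefined] by linarith
  have "(norm x)\<^sup>2 = (\<Sum>i\<in>UNIV. (x $ i)\<^sup>2)"
    unfolding power2_norm_eq_inner by (simp add: inner_vec_def power2_eq_square)
  also have "\<dots> \<le> (\<Sum>i\<in>(UNIV::'n set). b\<^sup>2)"
    by (intro sum_mono) (use assms b in \<open>simp add: abs_le_square_iff[symmetric]\<close>)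
  also have "\<dots> = (sqrt (real CARD('n)) * b)\<^sup>2"
    by (simp add: power_mult_distrib)
  finally show ?thesis by (rule power2_le_imp_le) (simp add: b)
qed

text \<open>The dimension arises as the product of two factors \<open>sqrt n\<close>: one from the
  norm of a row, one from the norm of the product vector.\<close>

lemma norm_matrix_vector_le_entries:
  fixes A :: "real^'n^'n"
  assumes "\<And>i j. \<bar>A $ i $ j\<bar> \<le> b"
  shows "norm (A *v v) \<le> real CARD('n) * b * norm v"
proof -
  have "\<bar>(A *v v) $ i\<bar> \<le> sqrt (real CARD('n)) * b * norm v" for i
  proof -
    have "\<bar>(A *v v) $ i\<bar> \<le> norm (A $ i) * norm v"
      by (metis Cauchy_Schwarz_ineq2 matrix_vector_mul_component)
    also have "\<dots> \<le> sqrt (real CARD('n)) * b * norm v"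
      by (intro mult_right_mono norm_le_sqrt_card assms) auto
    finally show ?thesis .
  qed
  from norm_le_sqrt_card[of "A *v v", OF this] show ?thesis
    by (simp add: mult.assoc[symmetric])
qed

section \<open>Taylor estimates\<close>

locale lipschitz_hessian =
  fixes f :: "real^'n \<Rightarrow> real" and L :: real
  assumes C2: "twice_continuously_differentiable f"
    and L_nonneg: "L \<ge> 0"
    and lipschitz: "spectral_norm (hessian f y - hessian f x) \<le> L * norm (y - x)"
begin

lemma differentiable: "f differentiable (at x)"
  and gradient_differentiable: "gradient f differentiable (at x)"
  using C2 by (auto simp: twice_continuously_differentiable_def)

lemma hessian_sym: "(hessian f x *v u) \<bullet> v = (hessian f x *v v) \<bullet> u"
  by (rule hessian_self_adjoint) (simp_all add: differentiable gradient_differentiable)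

lemma hessian_diff: "norm (hessian f y *v v - hessian f x *v v) \<le> L * norm (y - x) * norm v"
proof -
  have "norm ((hessian f y - hessian f x) *v v) \<le> spectral_norm (hessian f y - hessian f x) * norm v"
    by (rule norm_matrix_vector_le_spectral_norm)
  also have "\<dots> \<le> L * norm (y - x) * norm v"
    by (intro mult_right_mono lipschitz) auto
  finally show ?thesis by (simp add: matrix_vector_mult_diff_rdistrib)
qed

lemma gradient_along_line:
  "((\<lambda>t. gradient f (x + t *\<^sub>R d) \<bullet> w) has_real_derivative (hessian f (x + t *\<^sub>R d) *v d) \<bullet> w) (at t)"
proof -
  have "((\<lambda>t. x + t *\<^sub>R d) has_derivative (\<lambda>s. s *\<^sub>R d)) (at t)"
    by (auto intro!: derivative_eq_intros)
  from has_derivative_compose[OF this has_derivative_hessian[OF gradient_differentiable]]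
  have "((\<lambda>t. gradient f (x + t *\<^sub>R d)) has_derivative
      (\<lambda>s. hessian f (x + t *\<^sub>R d) *v (s *\<^sub>R d))) (at t)" .
  from has_derivative_inner_left[OF this, of w]
  show ?thesis
    by (simp add: has_field_derivative_def matrix_vector_mult_scaleR mult_commute_abs)
qed

text \<open>Pairing with \<open>w\<close> reduces the vector-valued remainder to a real function.
  \<open>\<phi>\<close> vanishes at 0, and the Lipschitz bound makes its derivative nonpositive,
  which replaces an integral remainder.\<close>

lemma gradient_taylor_inner:
  assumes "0 \<le> t"
  shows "(gradient f (x + t *\<^sub>R d) - gradient f x - t *\<^sub>R (hessian f x *v d)) \<bullet> w
    \<le> L / 2 * t\<^sup>2 * (norm d)\<^sup>2 * norm w"
proof -
  define \<phi> where "\<phi> t = gradient f (x + t *\<^sub>R d) \<bullet> w - gradient f x \<bullet> w - t * ((hessian f x *v d) \<bullet> w)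
    - L / 2 * (norm d)\<^sup>2 * norm w * t\<^sup>2" for t
  have "\<exists>D. (\<phi> has_real_derivative D) (at s) \<and> D \<le> 0" if "0 \<le> s" "s \<le> t" for s
  proof (intro exI conjI)
    show "(\<phi> has_real_derivative ((hessian f (x + s *\<^sub>R d) *v d) \<bullet> w - (hessian f x *v d) \<bullet> w
        - L * s * (norm d)\<^sup>2 * norm w)) (at s)"
      unfolding \<phi>_def by (auto intro!: derivative_eq_intros gradient_along_line)
    have "(hessian f (x + s *\<^sub>R d) *v d) \<bullet> w - (hessian f x *v d) \<bullet> w
        = (hessian f (x + s *\<^sub>R d) *v d - hessian f x *v d) \<bullet> w"
      by (simp add: inner_diff_left)
    also have "\<dots> \<le> norm (hessian f (x + s *\<^sub>R d) *v d - hessian f x *v d) * norm w"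
      by (rule norm_cauchy_schwarz)
    also have "\<dots> \<le> L * norm (x + s *\<^sub>R d - x) * norm d * norm w"
      by (intro mult_right_mono hessian_diff) auto
    also have "\<dots> = L * s * (norm d)\<^sup>2 * norm w"
      using that by (simp add: power2_eq_square)
    finally show "(hessian f (x + s *\<^sub>R d) *v d) \<bullet> w - (hessian f x *v d) \<bullet> w
        - L * s * (norm d)\<^sup>2 * norm w \<le> 0" by simp
  qed
  from DERIV_nonpos_imp_nonincreasing[OF assms this]
  have "\<phi> t \<le> \<phi> 0" by blast
  then show ?thesis by (simp add: \<phi>_def inner_diff_left algebra_simps)
qed

lemma gradient_taylor:
  "norm (gradient f (x + d) - gradient f x - hessian f x *v d) \<le> L / 2 * (norm d)\<^sup>2"
proof -
  \<comment> \<open>Testing the remainder against itself and dividing by its norm gives the norm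
    bound.\<close>
  let ?w = "gradient f (x + d) - gradient f x - hessian f x *v d"
  have "norm ?w * norm ?w \<le> L / 2 * (norm d)\<^sup>2 * norm ?w"
    using gradient_taylor_inner[of 1 x d ?w] by (simp add: norm_eq_sqrt_inner)
  then show ?thesis
    using L_nonneg by (cases "norm ?w = 0") (simp, simp only: mult_le_cancel_right, force)
qed

text \<open>The sign \<open>c\<close> lets a single monotonicity argument give both the upper and
  the lower bound of \<open>taylor\<close>.\<close>

lemma taylor_upper:
  assumes c: "c = 1 \<or> c = -1"
  shows "c * (f (x + d) - f x - gradient f x \<bullet> d - 1/2 * ((hessian f x *v d) \<bullet> d)) \<le> L / 6 * norm d ^ 3"
proof -
  define \<phi> where "\<phi> t = c * (f (x + t *\<^sub>R d) - f x - t * (gradient f x \<bullet> d)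
      - 1/2 * t\<^sup>2 * ((hessian f x *v d) \<bullet> d)) - L / 6 * norm d ^ 3 * t ^ 3" for t
  have "\<exists>D. (\<phi> has_real_derivative D) (at s) \<and> D \<le> 0" if "0 \<le> s" for s
  proof (intro exI conjI)
    show "(\<phi> has_real_derivative (c * (gradient f (x + s *\<^sub>R d) \<bullet> d - gradient f x \<bullet> d
        - s * ((hessian f x *v d) \<bullet> d)) - L / 2 * norm d ^ 3 * s\<^sup>2)) (at s)"
      unfolding \<phi>_def
      by (auto intro!: derivative_eq_intros has_real_derivative_along_line differentiable
          simp: algebra_simps)
    \<comment> \<open>The sign is moved into the test vector \<open>c *\<^sub>R d\<close>, whose
      norm is that of \<open>d\<close>.\<close>
    have "c * (gradient f (x + s *\<^sub>R d) \<bullet> d - gradient f x \<bullet> d - s * ((hessian f x *v d) \<bullet> d))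
      = (gradient f (x + s *\<^sub>R d) - gradient f x - s *\<^sub>R (hessian f x *v d)) \<bullet> (c *\<^sub>R d)"
      by (simp add: inner_diff_left)
    also have "\<dots> \<le> L / 2 * s\<^sup>2 * (norm d)\<^sup>2 * norm (c *\<^sub>R d)"
      by (rule gradient_taylor_inner[OF that])
    also have "\<dots> = L / 2 * norm d ^ 3 * s\<^sup>2"
      using c by (auto simp: power2_eq_square power3_eq_cube)
    finally show "c * (gradient f (x + s *\<^sub>R d) \<bullet> d - gradient f x \<bullet> d
        - s * ((hessian f x *v d) \<bullet> d)) - L / 2 * norm d ^ 3 * s\<^sup>2 \<le> 0" by simp
  qed
  from DERIV_nonpos_imp_nonincreasing[OF zero_le_one this]
  have "\<phi> 1 \<le> \<phi> 0" by blast
  then show ?thesis by (simp add: \<phi>_def)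
qed

lemma taylor:
  "\<bar>f (x + d) - f x - gradient f x \<bullet> d - 1/2 * ((hessian f x *v d) \<bullet> d)\<bar> \<le> L / 6 * norm d ^ 3"
  using taylor_upper[of 1 x d] taylor_upper[of "-1" x d] unfolding abs_le_iff by simp

section \<open>Errors of the finite differences\<close>

text \<open>In the central difference the quadratic Taylor terms cancel, so each entry keeps only
  two cubic remainders divided by \<open>2 * h\<close>; passing from entries to the norm costs
  \<open>sqrt n\<close>.\<close>

lemma fd_gradient_error:
  assumes h: "h > 0"
  shows "norm (fd_gradient f h x - gradient f x) \<le> sqrt (real CARD('n)) * (L * h\<^sup>2 / 6)"
proof (rule norm_le_sqrt_card)
  fix i
  let ?e = "axis i 1 :: real^'n"
  have "\<bar>f (x + h *\<^sub>R ?e) - f x - gradient f x \<bullet> (h *\<^sub>R ?e)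
      - 1/2 * ((hessian f x *v (h *\<^sub>R ?e)) \<bullet> (h *\<^sub>R ?e))\<bar> \<le> L / 6 * h ^ 3"
    using taylor[of x "h *\<^sub>R ?e"] h by (simp add: norm_axis_1)
  moreover have "\<bar>f (x - h *\<^sub>R ?e) - f x + gradient f x \<bullet> (h *\<^sub>R ?e)
      - 1/2 * ((hessian f x *v (h *\<^sub>R ?e)) \<bullet> (h *\<^sub>R ?e))\<bar> \<le> L / 6 * h ^ 3"
    using taylor[of x "- (h *\<^sub>R ?e)"] h linear_neg[OF matrix_vector_mul_linear, of "hessian f x" "h *\<^sub>R ?e"]
    by (simp add: norm_axis_1)
  ultimately have "\<bar>f (x + h *\<^sub>R ?e) - f (x - h *\<^sub>R ?e) - 2 * (gradient f x \<bullet> (h *\<^sub>R ?e))\<bar> \<le> L / 3 * h ^ 3"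
    by linarith
  then have "\<bar>f (x + h *\<^sub>R ?e) - f (x - h *\<^sub>R ?e) - 2 * (h * gradient f x $ i)\<bar> / (2 * h) \<le> L / 3 * h ^ 3 / (2 * h)"
    using h by (intro divide_right_mono) (simp_all add: inner_axis)
  moreover have "(fd_gradient f h x - gradient f x) $ i
      = (f (x + h *\<^sub>R ?e) - f (x - h *\<^sub>R ?e) - 2 * (h * gradient f x $ i)) / (2 * h)"
    using h by (simp add: fd_gradient_def field_simps)
  ultimately show "\<bar>(fd_gradient f h x - gradient f x) $ i\<bar> \<le> L * h\<^sup>2 / 6"
    using h by (simp add: abs_divide power2_eq_square power3_eq_cube)
qed

text \<open>The three Taylor remainders add up to \<open>(8 + 1 + 1) / 6 = 5/3\<close> times
  \<open>L * h^3\<close>, where 8 comes from a displacement of length at most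
  \<open>2 * h\<close>.\<close>

lemma fd_matrix_error:
  assumes h: "h > 0"
  shows "\<bar>fd_matrix f h x $ i $ j - hessian f x $ i $ j\<bar> \<le> 5/3 * L * h"
proof -
  let ?u = "h *\<^sub>R axis i 1 :: real^'n" and ?v = "h *\<^sub>R axis j 1 :: real^'n"
  let ?q = "\<lambda>d. gradient f x \<bullet> d + 1/2 * ((hessian f x *v d) \<bullet> d)"
  have nu: "norm ?u = h" "norm ?v = h" using h by (simp_all add: norm_axis_1)
  have "norm (?u + ?v) \<le> 2 * h" using norm_triangle_ineq[of ?u ?v] nu by simp
  then have "norm (?u + ?v) ^ 3 \<le> (2 * h) ^ 3" by (rule power_mono) simp
  then have "L / 6 * norm (?u + ?v) ^ 3 \<le> L / 6 * (8 * h ^ 3)"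
    using L_nonneg by (intro mult_left_mono) (auto simp: power_mult_distrib)
  with taylor[of x "?u + ?v"]
  have 1: "\<bar>f (x + ?u + ?v) - f x - ?q (?u + ?v)\<bar> \<le> 8/6 * L * h ^ 3"
    unfolding add.assoc diff_diff_eq by linarith
  have 2: "\<bar>f (x + ?u) - f x - ?q ?u\<bar> \<le> L / 6 * h ^ 3" using taylor[of x ?u] unfolding nu diff_diff_eq by linarith
  have 3: "\<bar>f (x + ?v) - f x - ?q ?v\<bar> \<le> L / 6 * h ^ 3" using taylor[of x ?v] unfolding nu diff_diff_eq by linarith
  \<comment> \<open>On the quadratic Taylor polynomial the second difference is exact: it leaves the
    mixed term, whose two halves agree because the Hessian is symmetric.\<close>
  have "?q (u + v) - ?q u - ?q v = (hessian f x *v v) \<bullet> u" for u v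
    using hessian_sym[of x u v]
    by (simp add: matrix_vector_right_distrib inner_add_left inner_add_right field_simps)
  then have "?q (?u + ?v) - ?q ?u - ?q ?v = (hessian f x *v ?v) \<bullet> ?u" .
  also have "\<dots> = h\<^sup>2 * hessian f x $ i $ j"
    by (simp add: matrix_vector_mult_scaleR inner_axis matrix_vector_mult_basis column_def power2_eq_square)
  finally have "\<bar>f (x + ?u + ?v) - f (x + ?u) - f (x + ?v) + f x - h\<^sup>2 * hessian f x $ i $ j\<bar>
      \<le> 5/3 * L * h ^ 3"
    using 1 2 3 by linarith
  then have "\<bar>f (x + ?u + ?v) - f (x + ?u) - f (x + ?v) + f x - h\<^sup>2 * hessian f x $ i $ j\<bar> / h\<^sup>2
      \<le> 5/3 * L * h ^ 3 / h\<^sup>2"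
    by (rule divide_right_mono) simp
  moreover have "fd_matrix f h x $ i $ j - hessian f x $ i $ j =
      (f (x + ?u + ?v) - f (x + ?u) - f (x + ?v) + f x - h\<^sup>2 * hessian f x $ i $ j) / h\<^sup>2"
    using h by (simp add: fd_matrix_def field_simps)
  ultimately show ?thesis
    using h by (simp add: abs_divide power2_eq_square power3_eq_cube)
qed

text \<open>Since the Hessian is symmetric, averaging the difference matrix with its transpose does
  not enlarge the entrywise error bound.\<close>

lemma fd_hessian_error:
  assumes h: "h > 0"
  shows "norm (fd_hessian f h x *v v - hessian f x *v v) \<le> real CARD('n) * (5/3 * L * h) * norm v"
proof -
  have "\<bar>(fd_hessian f h x - hessian f x) $ i $ j\<bar> \<le> 5/3 * L * h" for i j
  proof -
    have "hessian f x $ i $ j = hessian f x $ j $ i"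
      using hessian_sym[of x "axis j 1" "axis i 1"]
      by (simp add: inner_axis matrix_vector_mult_basis column_def)
    moreover have "fd_hessian f h x $ i $ j = 1/2 * (fd_matrix f h x $ i $ j + fd_matrix f h x $ j $ i)"
      by (simp add: fd_hessian_def transpose_def)
    ultimately show ?thesis
      using fd_matrix_error[OF h, of x i j] fd_matrix_error[OF h, of x j i]
      unfolding vector_minus_component abs_le_iff by (simp add: field_simps)
  qed
  from norm_matrix_vector_le_entries[OF this] show ?thesis
    by (simp add: matrix_vector_mult_diff_rdistrib)
qed

end

lemma fd_hessian_sym: "(fd_hessian f h x *v u) \<bullet> v = (fd_hessian f h x *v v) \<bullet> u"
proof -
  have "transpose (fd_hessian f h x) = fd_hessian f h x"
    by (simp add: fd_hessian_def transpose_def vec_eq_iff add.commute)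
  then show ?thesis
    by (metis dot_lmul_matrix inner_commute transpose_matrix_vector)
qed

section \<open>Composite objective and cubic steps\<close>

lemma finite_part_eq:
  assumes "proper_closed_convex \<psi>" "x \<in> edom \<psi>"
  shows "\<psi> x = ereal (finite_part \<psi> x)"
  using assms by (auto simp: proper_closed_convex_def edom_def finite_part_def ereal_real)

text \<open>Subtracting the supporting affine function leaves a function with a minimum at the
  interior point \<open>y\<close>, so its derivative vanishes there. This passes from the
  subgradient in the step condition to the gradient in the definition of a hit.\<close>

lemma subgradient_eq_gradient:
  assumes pcc: "proper_closed_convex \<psi>" and diff: "twice_differentiable_at \<psi> y"
    and p: "p \<in> subdifferential \<psi> y"
  shows "p = gradient (finite_part \<psi>) y"
proof -
  let ?S = "interior (edom \<psi>)" and ?g = "gradient (finite_part \<psi>) y"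
  have y: "y \<in> ?S" using diff by (simp add: twice_differentiable_at_def)
  have "finite_part \<psi> differentiable (at y)"
    using diff by (auto simp: twice_differentiable_at_def dest: eventually_nhds_x_imp_x)
  then have "(finite_part \<psi> has_derivative (\<lambda>d. ?g \<bullet> d)) (at y)"
    by (rule has_derivative_gradient)
  then have "((\<lambda>z. finite_part \<psi> z - p \<bullet> (z - y)) has_derivative (\<lambda>d. ?g \<bullet> d - p \<bullet> d)) (at y)"
    by (auto intro!: derivative_eq_intros)
  moreover have "finite_part \<psi> y - p \<bullet> (y - y) \<le> finite_part \<psi> z - p \<bullet> (z - y)" if "z \<in> ?S" for z
  proof -
    have "\<psi> y = ereal (finite_part \<psi> y)" "\<psi> z = ereal (finite_part \<psi> z)"
      using finite_part_eq[OF pcc] y that interior_subset by blast+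
    moreover have "\<psi> y + ereal (p \<bullet> (z - y)) \<le> \<psi> z"
      using p by (simp add: subdifferential_def)
    ultimately show ?thesis by simp
  qed
  ultimately have "(\<lambda>d. ?g \<bullet> d - p \<bullet> d) = (\<lambda>d. 0)"
    using y by (intro differential_zero_maxmin[of y ?S]) auto
  from fun_cong[OF this, of "?g - p"] have "(?g - p) \<bullet> (?g - p) = 0"
    by (simp add: inner_diff_left)
  then show ?thesis by simp
qed

text \<open>At \<open>y = x\<close> the norm is not differentiable, but its cube is
  \<open>o(norm h)\<close>; elsewhere the chain rule applies.\<close>

lemma has_derivative_norm_cubed:
  fixes x :: "'a::real_inner"
  shows "((\<lambda>y. norm (y - x) ^ 3) has_derivative (\<lambda>d. 3 * norm (y - x) * ((y - x) \<bullet> d))) (at y)"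
proof (cases "y = x")
  case True
  have "((\<lambda>h::'a. (norm h)\<^sup>2) \<longlongrightarrow> 0) (at 0)"
    by (auto intro!: tendsto_eq_intros)
  then have "((\<lambda>h::'a. norm (norm h ^ 3) / norm h) \<longlongrightarrow> 0) (at 0)"
    by (rule Lim_transform_eventually)
      (auto simp: eventually_at_filter power2_eq_square power3_eq_cube)
  then show ?thesis using True by (simp add: has_derivative_at)
next
  case False
  have "((\<lambda>y. norm (y - x)) has_derivative (\<lambda>d. sgn (y - x) \<bullet> d)) (at y)"
    by (rule has_derivative_compose[where g = norm and f = "\<lambda>y. y - x", THEN has_derivative_eq_rhs])
      (use False in \<open>auto intro!: derivative_eq_intros has_derivative_norm simp: inner_commute\<close>)
  from has_derivative_power[OF this, of 3] show ?thesis
    by (rule has_derivative_eq_rhs) (use False in \<open>simp add: fun_eq_iff sgn_div_norm power2_eq_square\<close>)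
qed

lemma gradient_cubic_model:
  fixes B :: "real^'n^'n"
  assumes sym: "\<And>u v. (B *v u) \<bullet> v = (B *v v) \<bullet> u"
  shows "gradient (cubic_model f g B \<sigma> x) y = g + B *v (y - x) + (\<sigma> / 2 * norm (y - x)) *\<^sub>R (y - x)"
proof (rule gradient_eqI)
  have mult: "((\<lambda>y. B *v (y - x)) has_derivative (\<lambda>d. B *v d)) (at y)"
    by (rule bounded_linear.has_derivative[OF matrix_vector_mul_bounded_linear])
      (auto intro!: derivative_eq_intros)
  \<comment> \<open>Named as one function so that the cubic term is differentiated as a whole, which
    covers \<open>y = x\<close>.\<close>
  define N where "N y = norm (y - x) ^ 3" for y :: "real^'n"
  have N: "(N has_derivative (\<lambda>d. 3 * norm (y - x) * ((y - x) \<bullet> d))) (at y)"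
    unfolding N_def by (rule has_derivative_norm_cubed)
  have model: "cubic_model f g B \<sigma> x =
      (\<lambda>y. f x + g \<bullet> (y - x) + 1/2 * ((B *v (y - x)) \<bullet> (y - x)) + \<sigma> / 6 * N y)"
    by (simp add: fun_eq_iff cubic_model_def N_def)
  have "(cubic_model f g B \<sigma> x has_derivative (\<lambda>d. g \<bullet> d
      + 1/2 * ((B *v (y - x)) \<bullet> d + (B *v d) \<bullet> (y - x))
      + \<sigma> / 6 * (3 * norm (y - x) * ((y - x) \<bullet> d)))) (at y)"
    unfolding model by (auto intro!: derivative_eq_intros N mult)
  then show "(cubic_model f g B \<sigma> x has_derivative
      (\<lambda>d. (g + B *v (y - x) + (\<sigma> / 2 * norm (y - x)) *\<^sub>R (y - x)) \<bullet> d)) (at y)"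
    by (rule has_derivative_eq_rhs) (simp add: fun_eq_iff inner_add_left sym[of _ "y - x"])
qed

section \<open>Hessian of the composite objective\<close>

lemma hessian_add_eventually:
  fixes f g F :: "real^'n \<Rightarrow> real"
  assumes F: "\<forall>\<^sub>F z in nhds x. F z = f z + g z"
    and f: "\<forall>\<^sub>F z in nhds x. f differentiable (at z)" "gradient f differentiable (at x)"
    and g: "\<forall>\<^sub>F z in nhds x. g differentiable (at z)" "gradient g differentiable (at x)"
  shows "hessian F x = hessian f x + hessian g x"
    and "\<forall>\<^sub>F z in nhds x. F differentiable (at z)" "gradient F differentiable (at x)"
proof -
  \<comment> \<open>Before the gradients can be differentiated they must agree in a whole
    neighbourhood of \<open>x\<close>, and this takes local agreement of \<open>F\<close> with the
    sum around every nearby point.\<close>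
  from F have "\<forall>\<^sub>F z in nhds x. \<forall>\<^sub>F w in nhds z. F w = f w + g w"
    by (simp only: eventually_eventually)
  with f(1) g(1)
  have ev: "\<forall>\<^sub>F z in nhds x. gradient f z + gradient g z = gradient F z \<and> F differentiable (at z)"
  proof eventually_elim
    case (elim z)
    have fg: "(\<lambda>z. f z + g z) differentiable (at z)" using elim(1,2) by (rule differentiable_add)
    have "gradient F z = gradient f z + gradient g z"
      using gradient_transform_eventually[OF elim(3) fg] gradient_add[OF elim(1,2)] by simp
    moreover have "F differentiable (at z)"
    proof -
      obtain D where D: "((\<lambda>z. f z + g z) has_derivative D) (at z)"
        using fg by (auto simp: differentiable_def)
      have "(F has_derivative D) (at z)"
      proof (rule has_derivative_transform_eventually[OF D])
        show "\<forall>\<^sub>F w in at z. f w + g w = F w"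
          unfolding eventually_at_filter using elim(3) by (rule eventually_mono) simp
        show "f z + g z = F z" using eventually_nhds_x_imp_x[OF elim(3)] by simp
      qed simp
      then show ?thesis by (auto simp: differentiable_def)
    qed
    ultimately show ?case by simp
  qed
  have "((\<lambda>z. gradient f z + gradient g z) has_derivative (\<lambda>d. (hessian f x + hessian g x) *v d)) (at x)"
    using has_derivative_add[OF has_derivative_hessian[OF f(2)] has_derivative_hessian[OF g(2)]]
    by (simp add: matrix_vector_mult_add_rdistrib)
  then have "(gradient F has_derivative (\<lambda>d. (hessian f x + hessian g x) *v d)) (at x)"
  proof (rule has_derivative_transform_eventually)
    show "\<forall>\<^sub>F w in at x. gradient f w + gradient g w = gradient F w"
      unfolding eventually_at_filter using ev by (rule eventually_mono) simp
    show "gradient f x + gradient g x = gradient F x" using eventually_nhds_x_imp_x[OF ev] by simp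
  qed simp
  then show "hessian F x = hessian f x + hessian g x" "gradient F differentiable (at x)"
    by (auto intro: hessian_eqI simp: differentiable_def)
  show "\<forall>\<^sub>F z in nhds x. F differentiable (at z)"
    using ev by (rule eventually_mono) simp
qed

locale composite = lipschitz_hessian f L for f :: "real^'n \<Rightarrow> real" and L :: real +
  fixes \<psi> :: "real^'n \<Rightarrow> ereal"
  assumes pcc: "proper_closed_convex \<psi>"
    and smooth: "x \<in> edom \<psi> \<Longrightarrow> twice_differentiable_at \<psi> x"
begin

text \<open>Real-valued form of the objective. It represents the objective on
  \<open>edom \<psi>\<close> only: where \<psi> is infinite, \<open>finite_part\<close> is
  0.\<close>

definition F :: "real^'n \<Rightarrow> real" where
  "F x = f x + finite_part \<psi> x"

lemma objective_eq: "x \<in> edom \<psi> \<Longrightarrow> objective f \<psi> x = ereal (F x)"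
  using finite_part_eq[OF pcc] by (simp add: objective_def F_def)

text \<open>The domain is a neighbourhood of each of its points, so near \<open>x\<close> the
  objective is the sum of two real functions. Symmetry makes \<open>lambda_min\<close> usable for
  the objective.\<close>

lemma hessian_objective:
  assumes x: "x \<in> edom \<psi>"
  shows "hessian (finite_part (objective f \<psi>)) x = hessian f x + hessian (finite_part \<psi>) x" (is ?eq)
    and "(hessian (finite_part (objective f \<psi>)) x *v u) \<bullet> v
      = (hessian (finite_part (objective f \<psi>)) x *v v) \<bullet> u" (is ?sym)
proof -
  note td = smooth[OF x, unfolded twice_differentiable_at_def]
  have "\<forall>\<^sub>F z in nhds x. z \<in> interior (edom \<psi>)"
    using td by (intro eventually_nhds_in_open) auto
  then have ev: "\<forall>\<^sub>F z in nhds x. finite_part (objective f \<psi>) z = f z + finite_part \<psi> z"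
  proof (rule eventually_mono)
    fix z assume "z \<in> interior (edom \<psi>)"
    then have "z \<in> edom \<psi>" using interior_subset by blast
    then show "finite_part (objective f \<psi>) z = f z + finite_part \<psi> z"
      using objective_eq[of z] by (simp add: finite_part_def F_def)
  qed
  note sum = hessian_add_eventually[OF ev _ gradient_differentiable]
  show ?eq by (rule sum(1)) (use td differentiable in auto)
  show ?sym
    by (rule hessian_self_adjoint) (rule sum(2) sum(3); use td differentiable in auto)+
qed

end

section \<open>Estimates for a single cubic step\<close>

text \<open>Here \<open>z\<close> is the first iterate of the call, where the Hessian is
  approximated once and for all, \<open>x\<close> the current iterate and \<open>y\<close> the next
  one. Reusing the Hessian of \<open>z\<close> at a point \<open>w\<close> costs the extra error
  \<open>L * norm (w - z)\<close>.\<close>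

locale cubic_step = composite f L \<psi> for f :: "real^'n \<Rightarrow> real" and L \<psi> +
  fixes z x y g :: "real^'n" and B :: "real^'n^'n" and \<sigma> dg dB :: real
  assumes x: "x \<in> edom \<psi>"
    and step: "approx_cubic_step f \<psi> g B \<sigma> x y"
    and B_sym: "(B *v u) \<bullet> v = (B *v v) \<bullet> u"
    and g_error: "norm (g - gradient f x) \<le> dg"
    and B_error: "norm (B *v v - hessian f z *v v) \<le> dB * norm v"
begin

lemma y: "y \<in> edom \<psi>"
  using step by (simp add: approx_cubic_step_def)

lemma B_hessian_diff:
  "norm (B *v v - hessian f w *v v) \<le> (dB + L * norm (w - z)) * norm v"
proof -
  have "norm (B *v v - hessian f w *v v) \<le>
      norm (B *v v - hessian f z *v v) + norm (hessian f w *v v - hessian f z *v v)"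
    using norm_triangle_ineq4[of "B *v v - hessian f z *v v" "hessian f w *v v - hessian f z *v v"] by simp
  also have "\<dots> \<le> dB * norm v + L * norm (w - z) * norm v"
    by (intro add_mono B_error hessian_diff)
  finally show ?thesis by (simp add: distrib_right)
qed

text \<open>The model with \<psi> added does not exceed \<open>F x\<close> at \<open>y\<close>.
  Comparing it with the Taylor expansion of \<open>f\<close> costs the two difference errors and the
  cubic remainder, which is set off against the regularization term.\<close>

lemma step_decrease:
  "F y \<le> F x + dg * norm (y - x) + 1/2 * (dB + L * norm (x - z)) * (norm (y - x))\<^sup>2
     + (L - \<sigma>) / 6 * norm (y - x) ^ 3"
proof -
  let ?d = "y - x"
  have "ereal (cubic_model f g B \<sigma> x y) + \<psi> y \<le> objective f \<psi> x"
    using step by (simp add: approx_cubic_step_def)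
  then have "cubic_model f g B \<sigma> x y + finite_part \<psi> y \<le> F x"
    using finite_part_eq[OF pcc y] objective_eq[OF x] by simp
  moreover have "f y \<le> f x + gradient f x \<bullet> ?d + 1/2 * ((hessian f x *v ?d) \<bullet> ?d) + L / 6 * norm ?d ^ 3"
    using taylor_upper[of 1 x ?d] by simp
  moreover have "gradient f x \<bullet> ?d - g \<bullet> ?d \<le> dg * norm ?d"
  proof -
    have "gradient f x \<bullet> ?d - g \<bullet> ?d \<le> norm (gradient f x - g) * norm ?d"
      by (metis inner_diff_left norm_cauchy_schwarz)
    also have "\<dots> \<le> dg * norm ?d"
      using g_error by (intro mult_right_mono) (auto simp: norm_minus_commute)
    finally show ?thesis .
  qed
  moreover have "(hessian f x *v ?d) \<bullet> ?d - (B *v ?d) \<bullet> ?d \<le> (dB + L * norm (x - z)) * (norm ?d)\<^sup>2"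
  proof -
    have "(hessian f x *v ?d) \<bullet> ?d - (B *v ?d) \<bullet> ?d \<le> norm (hessian f x *v ?d - B *v ?d) * norm ?d"
      by (metis inner_diff_left norm_cauchy_schwarz)
    also have "\<dots> \<le> (dB + L * norm (x - z)) * norm ?d * norm ?d"
      using B_hessian_diff[of ?d x] by (intro mult_right_mono) (auto simp: norm_minus_commute)
    finally show ?thesis by (simp add: power2_eq_square mult.assoc)
  qed
  ultimately show ?thesis
    unfolding cubic_model_def F_def by (simp add: field_simps)
qed

lemma step_gradient:
  assumes "\<sigma> \<ge> 0"
  shows "norm (gradient f y + gradient (finite_part \<psi>) y)
    \<le> (3/4 * \<sigma> + L / 2) * (norm (y - x))\<^sup>2 + dg + (dB + L * norm (x - z)) * norm (y - x)"
proof -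
  let ?d = "y - x" and ?p = "gradient (finite_part \<psi>) y"
  \<comment> \<open>The residual of the step condition is \<open>?a\<close>, the Taylor error of the
    gradient is \<open>?b\<close>, and \<open>?s\<close> comes from the cubic term of the model. The
    coefficient 3/4 of \<sigma> is 1/4 from \<open>?a\<close> plus 1/2 from
    \<open>?s\<close>.\<close>
  let ?a = "g + B *v ?d + (\<sigma> / 2 * norm ?d) *\<^sub>R ?d + ?p"
    and ?b = "gradient f (x + ?d) - gradient f x - hessian f x *v ?d"
    and ?c = "g - gradient f x" and ?e = "B *v ?d - hessian f x *v ?d"
    and ?s = "(\<sigma> / 2 * norm ?d) *\<^sub>R ?d"
  have "norm ?a \<le> \<sigma> / 4 * (norm ?d)\<^sup>2"
    using step subgradient_eq_gradient[OF pcc smooth[OF y]]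
    by (auto simp: approx_cubic_step_def gradient_cubic_model[OF B_sym])
  moreover have "norm ?b \<le> L / 2 * (norm ?d)\<^sup>2" by (rule gradient_taylor)
  moreover have "norm ?c \<le> dg" by (rule g_error)
  moreover have "norm ?e \<le> (dB + L * norm (x - z)) * norm ?d" by (rule B_hessian_diff)
  moreover have "norm ?s = \<sigma> / 2 * (norm ?d)\<^sup>2"
    using assms by (simp add: power2_eq_square)
  moreover have "gradient f y + ?p = ?a + ?b - ?c - ?e - ?s" by simp
  moreover have "norm (?a + ?b - ?c - ?e - ?s) \<le> norm ?a + norm ?b + norm ?c + norm ?e + norm ?s"
    by (intro order_trans[OF norm_triangle_ineq4] order_trans[OF norm_triangle_ineq] add_right_mono order_refl)
  ultimately show ?thesis by (simp add: algebra_simps)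
qed

text \<open>The semidefiniteness condition is tested at an eigenvector for the least eigenvalue of
  the Hessian of the objective. The Hessian of \<psi> occurs in both matrices, so only the error of
  \<open>B\<close> as an approximation of the Hessian of \<open>f\<close> at \<open>y\<close>
  remains.\<close>

lemma step_curvature:
  assumes "\<sigma> \<ge> 0" "dB \<ge> 0"
  shows "xi f \<psi> y \<le> \<sigma> * norm (y - x) + dB + L * norm (y - z)"
proof -
  let ?H = "hessian (finite_part (objective f \<psi>)) y" and ?r = "norm (y - x)"
  obtain v where v: "v \<noteq> 0" "?H *v v = lambda_min ?H *\<^sub>R v"
    using lambda_min_eigenvector[OF hessian_objective(2)[OF y]] .
  have "(B + (\<sigma> * ?r) *\<^sub>R mat 1 + hessian (finite_part \<psi>) y) *v v
      = B *v v + (\<sigma> * ?r) *\<^sub>R v + hessian (finite_part \<psi>) y *v v"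
    by (simp add: matrix_vector_mult_add_rdistrib scaleR_matrix_vector_assoc[symmetric])
  then have "0 \<le> (B *v v) \<bullet> v + \<sigma> * ?r * (v \<bullet> v) + (hessian (finite_part \<psi>) y *v v) \<bullet> v"
    using step by (auto simp: approx_cubic_step_def psd_def inner_add_left dest: spec[of _ v])
  moreover have "(hessian f y *v v) \<bullet> v + (hessian (finite_part \<psi>) y *v v) \<bullet> v = lambda_min ?H * (v \<bullet> v)"
    using v(2) unfolding hessian_objective(1)[OF y]
    by (metis inner_add_left inner_scaleR_left matrix_vector_mult_add_rdistrib)
  moreover have "(B *v v) \<bullet> v - (hessian f y *v v) \<bullet> v \<le> (dB + L * norm (y - z)) * (v \<bullet> v)"
  proof -
    have "(B *v v) \<bullet> v - (hessian f y *v v) \<bullet> v \<le> norm (B *v v - hessian f y *v v) * norm v"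
      by (metis inner_diff_left norm_cauchy_schwarz)
    also have "\<dots> \<le> (dB + L * norm (y - z)) * norm v * norm v"
      by (intro mult_right_mono B_hessian_diff) simp
    finally show ?thesis by (simp add: mult.assoc flip: power2_norm_eq_inner power2_eq_square)
  qed
  ultimately have "0 \<le> (\<sigma> * ?r + dB + L * norm (y - z) + lambda_min ?H) * (v \<bullet> v)"
    by (simp add: algebra_simps)
  then have "- lambda_min ?H \<le> \<sigma> * ?r + dB + L * norm (y - z)"
    by (smt (verit) v(1) inner_gt_zero_iff mult_neg_pos)
  then show ?thesis using assms L_nonneg by (simp add: xi_def)
qed

end

section \<open>Decrease in one call of the procedure\<close>

text \<open>Power mean inequality. The cube lies above its tangent at the mean \<open>a\<close> on
  the nonnegative reals, since the difference is \<open>(r - a)^2 * (r + 2 * a)\<close>; summing the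
  tangent bounds gives the claim.\<close>

lemma sum_cubed_le:
  fixes r :: "nat \<Rightarrow> real"
  assumes "\<And>i. i < k \<Longrightarrow> r i \<ge> 0"
  shows "(\<Sum>i<k. r i) ^ 3 \<le> (real k)\<^sup>2 * (\<Sum>i<k. r i ^ 3)"
proof (cases "k = 0")
  case False
  define a where "a = (\<Sum>i<k. r i) / real k"
  have a: "a \<ge> 0" using assms by (auto simp: a_def intro!: divide_nonneg_nonneg sum_nonneg)
  have "3 * a\<^sup>2 * r i - 2 * a ^ 3 \<le> r i ^ 3" if "i < k" for i
  proof -
    have "0 \<le> (r i - a)\<^sup>2 * (r i + 2 * a)" using assms[OF that] a by simp
    then show ?thesis by (simp add: power2_eq_square power3_eq_cube algebra_simps)
  qed
  then have "(\<Sum>i<k. 3 * a\<^sup>2 * r i - 2 * a ^ 3) \<le> (\<Sum>i<k. r i ^ 3)"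
    by (intro sum_mono) auto
  moreover have "(\<Sum>i<k. 3 * a\<^sup>2 * r i - 2 * a ^ 3) = 3 * a\<^sup>2 * (real k * a) - real k * (2 * a ^ 3)"
    using False by (simp add: sum_subtractf sum_distrib_left[symmetric]) (simp add: a_def)
  ultimately have "real k * a ^ 3 \<le> (\<Sum>i<k. r i ^ 3)"
    by (simp add: power2_eq_square power3_eq_cube algebra_simps)
  then have "(real k)\<^sup>2 * (real k * a ^ 3) \<le> (real k)\<^sup>2 * (\<Sum>i<k. r i ^ 3)"
    by (rule mult_left_mono) simp
  moreover have "(\<Sum>i<k. r i) = real k * a" using False by (simp add: a_def)
  ultimately show ?thesis by (simp add: power_mult_distrib power2_eq_square power3_eq_cube mult_ac)
qed simp

text \<open>
  The first alternative of \<open>large\<close> comes from a large gradient, the second from a large negative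
  curvature. Either the step \<open>r\<close> itself is long, or \<open>v\<close> is so large that \<open>- v\<^sup>3 / 50\<close> pays for
  everything.
\<close>

lemma step_progress_unit:
  fixes r v :: real
  assumes nonneg: "r \<ge> 0" "v \<ge> 0"
    and large: "1 < (3/4 + 1/26) * r\<^sup>2 + 1/150 + r/19 + v * r / 13 \<or> 19/10 < r + 1/19 + v/13"
  shows "1/384 + (r ^ 3 - v ^ 3) / 50 \<le> (1/6 - 1/78) * r ^ 3 - r\<^sup>2 / 38 - v * r\<^sup>2 / 26 - r / 150"
proof -
  define w where "w = v ^ 3"
  \<comment> \<open>This is the inequality of arithmetic and geometric means for \<open>v\<close>,
    \<open>r\<close>, \<open>r\<close>; it splits the mixed term \<open>v * r^2\<close> into
    cubes.\<close>
  have "0 \<le> (v - r)\<^sup>2 * (v + 2 * r)" using nonneg by simp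
  then have amgm: "3 * (v * r\<^sup>2) \<le> w + 2 * r ^ 3"
    by (simp add: w_def power2_eq_square power3_eq_cube algebra_simps)
  have w: "w \<ge> 0" using nonneg by (simp add: w_def)
  have "1/384 + (r ^ 3 - w) / 50 \<le> (1/6 - 1/78) * r ^ 3 - r\<^sup>2 / 38 - v * r\<^sup>2 / 26 - r / 150"
  \<comment> \<open>Above 3/4 the powers \<open>r\<close> and \<open>r^2\<close> are dominated by
    \<open>r^3\<close>. Below 3/4 both alternatives of \<open>large\<close> force
    \<open>v \<ge> 8\<close>.\<close>
  proof (cases "r \<ge> 3/4")
    case True
    have "r ^ 3 \<ge> (3/4) ^ 3" using True by (intro power_mono) auto
    then have r3: "r ^ 3 \<ge> 27/64" by (simp add: power_divide)
    have "3/4 * r\<^sup>2 \<le> r * r\<^sup>2" using True by (intro mult_right_mono) auto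
    then have r2: "r\<^sup>2 \<le> 4/3 * r ^ 3" by (simp add: power2_eq_square power3_eq_cube)
    have "3/4 * r \<le> r * r" using True by (intro mult_right_mono) auto
    then have "r \<le> 4/3 * r\<^sup>2" by (simp add: power2_eq_square)
    with r2 have r1: "r \<le> 16/9 * r ^ 3" by simp
    from r1 r2 r3 amgm w show ?thesis by argo
  next
    case False
    then have "r\<^sup>2 \<le> (3/4)\<^sup>2" using nonneg by (intro power_mono) auto
    then have r2: "r\<^sup>2 \<le> 9/16" by (simp add: power_divide)
    have "v * r \<le> v * (3/4)" using False nonneg by (intro mult_left_mono) auto
    with large False r2 have "v \<ge> 8" by argo
    then have "v ^ 3 \<ge> 8 ^ 3" by (intro power_mono) auto
    then have "w \<ge> 512" by (simp add: w_def)
    moreover have "r ^ 3 \<ge> 0" using nonneg by simp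
    ultimately show ?thesis using r2 amgm False by argo
  qed
  then show ?thesis by (simp only: w_def)
qed

text \<open>By homogeneity \<open>q = 1\<close> suffices: the alternatives of \<open>large\<close>
  have degrees 2 and 1 in \<open>(q, r, v)\<close>, the conclusion has degree 3.\<close>

lemma step_progress:
  fixes q r v :: real
  assumes q: "q > 0" and nonneg: "r \<ge> 0" "v \<ge> 0"
    and large: "q\<^sup>2 < (3/4 + 1/26) * r\<^sup>2 + q\<^sup>2/150 + q * r/19 + v * r / 13 \<or> 19/10 * q < r + q/19 + v/13"
  shows "q ^ 3 / 384 + (r ^ 3 - v ^ 3) / 50
    \<le> (1/6 - 1/78) * r ^ 3 - q * r\<^sup>2 / 38 - v * r\<^sup>2 / 26 - q\<^sup>2 * r / 150"
proof -
  define \<rho> \<nu> where "\<rho> = r / q" and "\<nu> = v / q"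
  have r: "r = q * \<rho>" and v: "v = q * \<nu>" using q by (simp_all add: \<rho>_def \<nu>_def)
  have nonneg': "\<rho> \<ge> 0" "\<nu> \<ge> 0" using nonneg q by (simp_all add: \<rho>_def \<nu>_def)
  have "q\<^sup>2 * 1 < q\<^sup>2 * ((3/4 + 1/26) * \<rho>\<^sup>2 + 1/150 + \<rho>/19 + \<nu> * \<rho> / 13)
      \<or> q * (19/10) < q * (\<rho> + 1/19 + \<nu>/13)"
    using large unfolding r v by (simp add: power2_eq_square algebra_simps)
  then have "1 < (3/4 + 1/26) * \<rho>\<^sup>2 + 1/150 + \<rho>/19 + \<nu> * \<rho> / 13 \<or> 19/10 < \<rho> + 1/19 + \<nu>/13"
    using q by (simp only: mult_less_cancel_left_pos zero_less_power)
  from step_progress_unit[OF nonneg' this]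
  have "q ^ 3 * (1/384 + (\<rho> ^ 3 - \<nu> ^ 3) / 50)
      \<le> q ^ 3 * ((1/6 - 1/78) * \<rho> ^ 3 - \<rho>\<^sup>2 / 38 - \<nu> * \<rho>\<^sup>2 / 26 - \<rho> / 150)"
    using q by (intro mult_left_mono) auto
  then show ?thesis unfolding r v by (simp add: power2_eq_square power3_eq_cube algebra_simps)
qed

section \<open>Numerical bounds for the parameters\<close>

lemma powr_third_cubed: "x \<ge> 0 \<Longrightarrow> (x powr (1/3)) ^ 3 = (x::real)"
  by (cases "x = 0") (simp_all add: powr_powr flip: powr_numeral powr_realpow)

lemma powr_three_halves: "x \<ge> 0 \<Longrightarrow> x powr (3/2) = sqrt x ^ 3"
  by (cases "x = 0") (simp_all add: powr_half_sqrt[symmetric] powr_powr flip: powr_numeral powr_realpow)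

lemma cube_root_bounds: "87/100 \<le> (2/3) powr (1/3::real)" "(2/3) powr (1/3::real) \<le> 88/100"
  by (rule power_le_imp_le_base[of _ 2], simp_all add: powr_third_cubed power_divide numeral_3_eq_3[symmetric])+

text \<open>The lower bound gives \<open>L * m \<le> \<sigma> / 13\<close> once
  \<open>L \<le> 2^l * \<tau>\<close>; the upper bound compares \<sigma> with the factor in the
  curvature threshold.\<close>

lemma reg_param_bounds:
  assumes "\<tau> > 0" "m \<ge> 1"
  shows "13 * (2 ^ l * \<tau> * real m) \<le> reg_param m \<tau> l" "reg_param m \<tau> l \<le> 29/2 * (2 ^ l * \<tau> * real m)"
    and "reg_param m \<tau> l > 0"
proof -
  let ?a = "(2/3) powr (1/3::real)" and ?M = "2 ^ l * \<tau> * real m"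
  have M: "?M > 0" using assms by simp
  have eq: "reg_param m \<tau> l = 16 * ?a * ?M" by (simp add: reg_param_def)
  have "13 * ?M \<le> 16 * ?a * ?M" "16 * ?a * ?M \<le> 29/2 * ?M"
    using cube_root_bounds M by (intro mult_right_mono; linarith)+
  then show "13 * ?M \<le> reg_param m \<tau> l" "reg_param m \<tau> l \<le> 29/2 * ?M" unfolding eq .
  with M show "reg_param m \<tau> l > 0" by linarith
qed

lemma grad_stepsize_bounds:
  assumes "\<sigma> > 0" "n \<ge> 1" "m \<ge> 1" "\<epsilon> > 0"
  shows "grad_stepsize n \<sigma> m \<epsilon> > 0"
    and "sqrt (real n) * (grad_stepsize n \<sigma> m \<epsilon>)\<^sup>2 \<le> \<epsilon> * real m / (2 * \<sigma>)"
proof -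
  let ?b = "(3::real) powr (1/3)"
  show "grad_stepsize n \<sigma> m \<epsilon> > 0" using assms by (simp add: grad_stepsize_def)
  \<comment> \<open>Since \<open>1.42^3 < 3\<close> and \<open>1.42^2 > 2\<close>, the factor
    \<open>3 powr (2/3)\<close> is at least 2.\<close>
  have "142/100 \<le> ?b"
    by (rule power_le_imp_le_base[of _ 2]) (simp_all add: powr_third_cubed power_divide numeral_3_eq_3[symmetric])
  then have "(142/100)\<^sup>2 \<le> ?b\<^sup>2" by (intro power_mono) auto
  then have b: "?b\<^sup>2 \<ge> 2" by (simp add: power_divide)
  have "sqrt (real n) * (grad_stepsize n \<sigma> m \<epsilon>)\<^sup>2 = \<epsilon> * real m / \<sigma> * (1 / ?b\<^sup>2)"
    using assms by (simp add: grad_stepsize_def power_mult_distrib power_divide)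
  also have "\<dots> \<le> \<epsilon> * real m / \<sigma> * (1 / 2)"
    using b assms by (intro mult_left_mono frac_le) auto
  finally show "sqrt (real n) * (grad_stepsize n \<sigma> m \<epsilon>)\<^sup>2 \<le> \<epsilon> * real m / (2 * \<sigma>)" by simp
qed

lemma hess_stepsize_bounds:
  assumes "\<tau> > 0" "n \<ge> 1" "m \<ge> 1" "\<epsilon> > 0"
  shows "hess_stepsize n m \<epsilon> \<tau> l > 0"
    and "real n * (2 ^ l * \<tau>) * hess_stepsize n m \<epsilon> \<tau> l \<le> sqrt (reg_param m \<tau> l * \<epsilon>) / 33"
proof -
  let ?\<sigma> = "reg_param m \<tau> l" and ?h = "hess_stepsize n m \<epsilon> \<tau> l"
  have \<sigma>: "?\<sigma> > 0" by (rule reg_param_bounds[OF assms(1,3)])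
  define W where "W = sqrt (?\<sigma> * \<epsilon>)"
  have W: "W > 0" using \<sigma> assms by (simp add: W_def)
  define P where "P = real n * (2 ^ l * \<tau>)"
  have P: "P > 0" using assms by (simp add: P_def)
  have "?\<sigma> powr (3/2) * \<epsilon> powr (3/2) = W ^ 3"
    using \<sigma> assms by (simp add: W_def powr_three_halves real_sqrt_mult power_mult_distrib)
  then have h: "?h = (81 * W ^ 3 / (2 ^ 14 * 192 * P ^ 3)) powr (1/3)"
    by (simp add: hess_stepsize_def P_def power_mult_distrib mult.assoc)
  show "?h > 0" unfolding h using W P by simp
  have "(P * ?h) ^ 3 = 81 / (2 ^ 14 * 192) * W ^ 3"
    using W P by (simp add: h power_mult_distrib powr_third_cubed)
  \<comment> \<open>The number 33 is admissible because
    \<open>81 * 33^3 \<le> 2^14 * 192\<close>.\<close>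
  also have "\<dots> \<le> (1 / 33) ^ 3 * W ^ 3"
    using W by (intro mult_right_mono) (auto simp: power_divide)
  also have "\<dots> = (W / 33) ^ 3" by (simp add: power_divide)
  finally have "P * ?h \<le> W / 33"
    using W by (intro power_le_imp_le_base[of "P * ?h" 2 "W / 33"]) (simp_all add: numeral_3_eq_3)
  then show "real n * (2 ^ l * \<tau>) * ?h \<le> sqrt (?\<sigma> * \<epsilon>) / 33" by (simp add: P_def W_def)
qed

context composite
begin

text \<open>All errors are measured against \<sigma>: \<open>L \<le> 2^l * \<tau>\<close> keeps them
  small, and \<open>2^l * \<tau> \<le> 2 * max \<tau>0 L\<close> keeps \<sigma> comparable with the
  curvature threshold. Single steps may increase the objective; only the sum over the steps is
  controlled.\<close>

lemma call_decrease:
  fixes y :: "nat \<Rightarrow> real^'n" and \<tau> \<tau>0 \<epsilon> :: real and m l t :: nat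
  defines "\<sigma> \<equiv> reg_param m \<tau> l"
  assumes pos: "\<tau> > 0" "\<epsilon> > 0" "m \<ge> 1" and t: "t + 1 \<le> m"
    and L_le: "L \<le> 2 ^ l * \<tau>" and le_Mx: "2 ^ l * \<tau> \<le> 2 * max \<tau>0 L"
    and y0: "y 0 \<in> edom \<psi>"
    and steps: "\<And>s. s \<le> t \<Longrightarrow> approx_cubic_step f \<psi> (fd_gradient f (grad_stepsize CARD('n) \<sigma> m \<epsilon>) (y s))
        (fd_hessian f (hess_stepsize CARD('n) m \<epsilon> \<tau> l) (y 0)) \<sigma> (y s) (y (s + 1))"
    and no_hit: "\<And>s. s \<le> t \<Longrightarrow> \<not> approx_second_order_point f \<psi> L \<tau>0 \<epsilon> m (y (s + 1))"
  shows "sufficient_decrease f \<psi> \<sigma> \<epsilon> y t"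
proof -
  let ?n = "CARD('n)" and ?Mx = "max \<tau>0 L"
  let ?hg = "grad_stepsize ?n \<sigma> m \<epsilon>" and ?h = "hess_stepsize ?n m \<epsilon> \<tau> l"
  let ?B = "fd_hessian f ?h (y 0)"
  note \<sigma>_bounds = reg_param_bounds[OF pos(1,3), of l, folded \<sigma>_def]
  have \<sigma>: "\<sigma> > 0" by (rule \<sigma>_bounds)
  have n: "?n \<ge> 1" by (simp add: Suc_leI)
  \<comment> \<open>The natural length scale: \<open>\<epsilon> = \<sigma> * q^2\<close>, and the
    decrease required per step is \<open>\<sigma> * q^3 / 384\<close>.\<close>
  define q where "q = sqrt (\<epsilon> / \<sigma>)"
  have q: "q > 0" using pos \<sigma> by (simp add: q_def)
  have \<epsilon>: "\<epsilon> = \<sigma> * q\<^sup>2" using pos \<sigma> by (simp add: q_def)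
  have sq: "sqrt (\<sigma> * \<epsilon>) = \<sigma> * q" using \<sigma> q by (simp add: \<epsilon> real_sqrt_mult power2_eq_square)
  have "L * real m \<le> 2 ^ l * \<tau> * real m" using L_le by (intro mult_right_mono) auto
  then have Lm: "L * real m \<le> \<sigma> / 13" using \<sigma>_bounds(1) by simp
  have L1: "L \<le> \<sigma> / 13"
    using Lm mult_left_mono[of 1 "real m" L] L_nonneg pos(3) by simp
  \<comment> \<open>The gradient error is at most
    \<open>\<epsilon> / (12 * 13) = \<epsilon> / 156\<close>, the Hessian error at most
    \<open>5/3 * \<sigma> * q / 33 = \<sigma> * q / 19.8\<close>; both are rounded up.\<close>
  define dg where "dg = \<sigma> * q\<^sup>2 / 150"
  define dB where "dB = \<sigma> * q / 19"
  have g_error: "norm (fd_gradient f ?hg x - gradient f x) \<le> dg" for x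
  proof -
    note hg = grad_stepsize_bounds[OF \<sigma> n pos(3,2)]
    have "norm (fd_gradient f ?hg x - gradient f x) \<le> L / 6 * (sqrt (real ?n) * ?hg\<^sup>2)"
      using fd_gradient_error[OF hg(1)] by (simp add: ac_simps)
    also have "\<dots> \<le> L / 6 * (\<epsilon> * real m / (2 * \<sigma>))"
      using hg(2) L_nonneg by (intro mult_left_mono) auto
    also have "\<dots> = L * real m * (\<epsilon> / (12 * \<sigma>))" by simp
    also have "\<dots> \<le> \<sigma> / 13 * (\<epsilon> / (12 * \<sigma>))"
      using Lm pos \<sigma> by (intro mult_right_mono) auto
    also have "\<dots> \<le> dg" using \<sigma> q by (simp add: dg_def \<epsilon>)
    finally show ?thesis .
  qed
  have B_error: "norm (?B *v v - hessian f (y 0) *v v) \<le> dB * norm v" for v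
  proof -
    note h = hess_stepsize_bounds[OF pos(1) n pos(3,2), of l, folded \<sigma>_def]
    have "norm (?B *v v - hessian f (y 0) *v v) \<le> real ?n * (5/3 * L * ?h) * norm v"
      by (rule fd_hessian_error[OF h(1)])
    also have "real ?n * (5/3 * L * ?h) = 5/3 * (real ?n * ?h) * L" by simp
    also have "\<dots> \<le> 5/3 * (real ?n * ?h) * (2 ^ l * \<tau>)"
      using L_le h(1) by (intro mult_left_mono) auto
    also have "\<dots> \<le> 5/3 * (\<sigma> * q / 33)" using h(2)[unfolded sq] by (simp add: mult_ac)
    also have "\<dots> \<le> dB" using \<sigma> q by (simp add: dB_def)
    finally show ?thesis by (simp add: mult_right_mono)
  qed
  have y_dom: "y s \<in> edom \<psi>" if "s \<le> t + 1" for s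
  proof (cases s)
    case (Suc s')
    then show ?thesis using steps[of s'] that by (simp add: approx_cubic_step_def)
  qed (use y0 in simp)
  have cs: "cubic_step f L \<psi> (y 0) (y s) (y (s + 1)) (fd_gradient f ?hg (y s)) ?B \<sigma> dg dB" if "s \<le> t" for s
    by unfold_locales
      (use that y_dom[of s] steps[OF that] g_error B_error fd_hessian_sym in auto)
  define r where "r s = norm (y (s + 1) - y s)" for s
  define S where "S s = (\<Sum>i<s. r i)" for s
  \<comment> \<open>The index \<open>s + 1\<close> includes the current step, so \<open>v s\<close>
    controls the distance of both \<open>y s\<close> and \<open>y (s + 1)\<close> from
    \<open>y 0\<close>. Dividing by \<open>m\<close> matches the bound on
    \<open>L * m\<close>.\<close>
  define v where "v s = S (s + 1) / real m" for s
  have r: "r s \<ge> 0" for s by (simp add: r_def)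
  have v: "v s \<ge> 0" for s using r by (simp add: v_def S_def sum_nonneg)
  have dist: "norm (y s - y 0) \<le> S s" for s
  proof (induction s)
    case (Suc s)
    have "norm (y (Suc s) - y 0) \<le> r s + norm (y s - y 0)"
      using norm_triangle_ineq[of "y (Suc s) - y s" "y s - y 0"] by (simp add: r_def)
    then show ?case using Suc by (simp add: S_def)
  qed (simp add: S_def)
  have LS: "L * S (s + 1) \<le> \<sigma> / 13 * v s" for s
  proof -
    have "L * S (s + 1) = L * real m * v s" using pos(3) by (simp add: v_def)
    also have "\<dots> \<le> \<sigma> / 13 * v s" using Lm v by (rule mult_right_mono)
    finally show ?thesis .
  qed
  have near: "L * norm (y s - y 0) \<le> \<sigma> / 13 * v s" "L * norm (y (s + 1) - y 0) \<le> \<sigma> / 13 * v s" for s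
  proof -
    have "S s \<le> S (s + 1)" using r by (simp add: S_def)
    then have "norm (y s - y 0) \<le> S (s + 1)" "norm (y (s + 1) - y 0) \<le> S (s + 1)"
      using dist[of s] dist[of "s + 1"] by auto
    then show "L * norm (y s - y 0) \<le> \<sigma> / 13 * v s" "L * norm (y (s + 1) - y 0) \<le> \<sigma> / 13 * v s"
      using LS[of s] L_nonneg by (meson mult_left_mono order_trans)+
  qed
  have progress: "\<sigma> * (q ^ 3 / 384 + (r s ^ 3 - v s ^ 3) / 50) \<le> F (y s) - F (y (s + 1))" if s: "s \<le> t" for s
  proof -
    note cubic_step = cs[OF s]
    have large: "q\<^sup>2 < (3/4 + 1/26) * (r s)\<^sup>2 + q\<^sup>2/150 + q * r s/19 + v s * r s / 13
        \<or> 19/10 * q < r s + q/19 + v s/13"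
    proof (cases "norm (gradient f (y (s + 1)) + gradient (finite_part \<psi>) (y (s + 1))) > \<epsilon>")
      case True
      have "norm (gradient f (y (s + 1)) + gradient (finite_part \<psi>) (y (s + 1)))
          \<le> (3/4 * \<sigma> + L / 2) * (r s)\<^sup>2 + dg + (dB + L * norm (y s - y 0)) * r s"
        using cubic_step.step_gradient[OF cubic_step] \<sigma> by (simp add: r_def)
      also have "\<dots> \<le> (3/4 * \<sigma> + \<sigma> / 13 / 2) * (r s)\<^sup>2 + dg + (dB + \<sigma> / 13 * v s) * r s"
        using L1 near(1)[of s] r \<sigma> by (intro add_mono mult_right_mono) auto
      also have "\<dots> = \<sigma> * ((3/4 + 1/26) * (r s)\<^sup>2 + q\<^sup>2/150 + q * r s/19 + v s * r s / 13)"
        by (simp add: dg_def dB_def field_simps)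
      finally have "\<sigma> * q\<^sup>2 < \<sigma> * ((3/4 + 1/26) * (r s)\<^sup>2 + q\<^sup>2/150 + q * r s/19 + v s * r s / 13)"
        using True by (simp only: \<epsilon>)
      then show ?thesis using \<sigma> by (simp only: mult_less_cancel_left_pos simp_thms)
    next
      case False
      let ?x = "xi f \<psi> (y (s + 1))"
      have Mx: "?Mx > 0" using le_Mx pos by (smt (verit) mult_pos_pos zero_less_power)
      have pos': "2\<^sup>2 * 3 ^ 3 * real m * ?Mx > 0" using Mx pos by simp
      have "\<epsilon> < 1 / (2\<^sup>2 * 3 ^ 3 * real m * ?Mx) * ?x\<^sup>2"
        using no_hit[OF s] False by (auto simp: approx_second_order_point_def)
      then have x: "108 * (?Mx * real m) * \<epsilon> < ?x\<^sup>2"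
        using pos' by (simp add: field_simps)
      have "2 ^ l * \<tau> * real m \<le> 2 * ?Mx * real m" using le_Mx by (rule mult_right_mono) simp
      then have "\<sigma> \<le> 29 * (?Mx * real m)" using \<sigma>_bounds(2) by simp
      then have "\<sigma> * \<epsilon> \<le> 29 * (?Mx * real m) * \<epsilon>" using pos by (intro mult_right_mono) auto
      moreover have "?Mx * real m * \<epsilon> > 0" using Mx pos by simp
      \<comment> \<open>Here \<open>361/100 = (19/10)^2\<close> and
        \<open>29 * 361/100 < 108 = 2^2 * 3^3\<close>, which is where the constant 19/10 comes
        from.\<close>
      ultimately have "361/100 * (\<sigma> * \<epsilon>) \<le> 108 * (?Mx * real m) * \<epsilon>" by simp
      also note x
      also have "361/100 * (\<sigma> * \<epsilon>) = (19/10 * (\<sigma> * q))\<^sup>2" by (simp add: \<epsilon> power2_eq_square)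
      finally have "19/10 * (\<sigma> * q) < ?x"
        by (rule power_less_imp_less_base) (simp add: xi_def)
      also have "?x \<le> \<sigma> * r s + dB + L * norm (y (s + 1) - y 0)"
        using cubic_step.step_curvature[OF cubic_step] \<sigma> q by (simp add: r_def dB_def)
      also have "\<dots> \<le> \<sigma> * r s + dB + \<sigma> / 13 * v s" using near(2)[of s] by simp
      also have "\<dots> = \<sigma> * (r s + q/19 + v s/13)" by (simp add: dB_def field_simps)
      finally have "\<sigma> * (19/10 * q) < \<sigma> * (r s + q/19 + v s/13)" by simp
      then show ?thesis using \<sigma> by (simp only: mult_less_cancel_left_pos simp_thms)
    qed
    have "F (y (s + 1)) - F (y s) \<le> dg * r s + 1/2 * (dB + L * norm (y s - y 0)) * (r s)\<^sup>2 + (L - \<sigma>) / 6 * r s ^ 3"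
      using cubic_step.step_decrease[OF cubic_step] by (simp add: r_def)
    also have "\<dots> \<le> dg * r s + 1/2 * (dB + \<sigma> / 13 * v s) * (r s)\<^sup>2 + (\<sigma> / 13 - \<sigma>) / 6 * r s ^ 3"
      using near(1)[of s] L1 r \<sigma> by (intro add_mono mult_right_mono) auto
    also have "\<dots> = - \<sigma> * ((1/6 - 1/78) * r s ^ 3 - q * (r s)\<^sup>2 / 38 - v s * (r s)\<^sup>2 / 26 - q\<^sup>2 * r s / 150)"
      by (simp add: dg_def dB_def field_simps)
    also have "\<dots> \<le> - \<sigma> * (q ^ 3 / 384 + (r s ^ 3 - v s ^ 3) / 50)"
      using step_progress[OF q r v large] \<sigma> by (intro mult_left_mono_neg) auto
    finally show ?thesis by simp
  qed
  define R where "R = (\<Sum>s<t+1. r s ^ 3)"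
  have R: "R \<ge> 0" using r by (simp add: R_def sum_nonneg)
  \<comment> \<open>By the power mean inequality each \<open>v s ^ 3\<close> is at most
    \<open>R / m\<close>, and there are at most \<open>m\<close> of them; hence the cubic terms have
    a nonnegative sum.\<close>
  have "(\<Sum>s<t+1. v s ^ 3) \<le> (\<Sum>s<t+1. R / real m)"
  proof (rule sum_mono)
    fix s assume "s \<in> {..<t + 1}"
    then have s: "s + 1 \<le> t + 1" by simp
    have "S (s + 1) ^ 3 \<le> (real (s + 1))\<^sup>2 * (\<Sum>i<s+1. r i ^ 3)"
      unfolding S_def using r by (rule sum_cubed_le)
    also have "\<dots> \<le> (real m)\<^sup>2 * R"
    proof (intro mult_mono power_mono)
      show "(\<Sum>i<s+1. r i ^ 3) \<le> R" unfolding R_def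
        using s r by (intro sum_mono2) auto
    qed (use s t r in \<open>auto intro!: sum_nonneg add_nonneg_nonneg\<close>)
    finally have "S (s + 1) ^ 3 / real m ^ 3 \<le> (real m)\<^sup>2 * R / real m ^ 3"
      by (rule divide_right_mono) simp
    then show "v s ^ 3 \<le> R / real m"
      using pos by (simp add: v_def power_divide power2_eq_square power3_eq_cube)
  qed
  also have "\<dots> = R / real m * real (t + 1)" by simp
  also have "\<dots> \<le> R / real m * real m" using t R by (intro mult_left_mono) auto
  also have "\<dots> = R" using pos by simp
  finally have vR: "(\<Sum>s<t+1. v s ^ 3) \<le> R" .
  have "\<epsilon> powr (3/2) / sqrt \<sigma> = \<sigma> * q ^ 3"
  proof -
    have "sqrt \<epsilon> = sqrt \<sigma> * q" using \<sigma> q by (simp add: \<epsilon> real_sqrt_mult)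
    then have "\<epsilon> powr (3/2) = (sqrt \<sigma>)\<^sup>2 * sqrt \<sigma> * q ^ 3"
      using pos by (simp add: powr_three_halves power_mult_distrib power2_eq_square power3_eq_cube)
    then show ?thesis using \<sigma> by simp
  qed
  then have "\<epsilon> powr (3/2) / (384 * sqrt \<sigma>) * real (t + 1) = \<sigma> * (q ^ 3 / 384) * real (t + 1)"
    by (simp add: divide_divide_eq_left[symmetric] mult.commute)
  also have "\<dots> \<le> \<sigma> * (real (t + 1) * (q ^ 3 / 384) + (R - (\<Sum>s<t+1. v s ^ 3)) / 50)"
    using vR \<sigma> by (simp add: mult.assoc mult.commute mult_left_mono)
  also have "\<dots> = (\<Sum>s<t+1. \<sigma> * (q ^ 3 / 384 + (r s ^ 3 - v s ^ 3) / 50))"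
    by (simp only: sum_distrib_left[symmetric] sum.distrib sum_divide_distrib[symmetric] sum_subtractf
        sum_constant card_lessThan R_def of_nat_add times_divide_eq_right)
  also have "\<dots> \<le> (\<Sum>s<t+1. F (y s) - F (y (s + 1)))"
    by (intro sum_mono progress) simp
  also have "\<dots> = F (y 0) - F (y (t + 1))"
    using sum_lessThan_telescope'[of "\<lambda>s. F (y s)" "t + 1"] by simp
  finally show ?thesis
    unfolding sufficient_decrease_def using objective_eq y_dom[of 0] y_dom[of "t + 1"] by simp
qed

end

section \<open>Runs of the algorithm\<close>

locale cnm_run = composite f L \<psi> for f :: "real^'n \<Rightarrow> real" and L \<psi> +
  fixes x0 :: "real^'n" and \<tau>0 \<epsilon> :: real and m :: nat and run :: "nat \<Rightarrow> 'n call"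
  assumes bounded: "opt_value f \<psi> > -\<infinity>"
    and x0: "x0 \<in> edom \<psi>" and \<tau>0: "\<tau>0 > 0" and \<epsilon>: "\<epsilon> > 0" and m: "m \<ge> 1"
    and run: "zero_order_CNM f \<psi> x0 \<tau>0 \<epsilon> m run"
begin

abbreviation "Mx \<equiv> max \<tau>0 L"

definition hits :: "nat \<Rightarrow> bool" where
  "hits c \<longleftrightarrow> (\<exists>t\<le>num_steps (run c). approx_second_order_point f \<psi> L \<tau>0 \<epsilon> m (iterates (run c) t))"

definition gap :: real where
  "gap = real_of_ereal (objective f \<psi> x0) - real_of_ereal (opt_value f \<psi>)"

text \<open>The inverse of \<open>rate\<close> is the decrease guaranteed by one outer iteration
  before a hit, so \<open>rate * gap\<close> is the bound on their number.\<close>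

definition rate :: real where
  "rate = 384 * 2 powr (5/2) * (2/3) powr (1/6) * sqrt Mx / sqrt (real m) * \<epsilon> powr (-3/2)"

lemma Mx_pos: "Mx > 0"
  using \<tau>0 by simp

lemma rate_pos: "rate > 0"
  using Mx_pos m \<epsilon> by (simp add: rate_def)

lemma decrease_le_gap:
  assumes "x \<in> edom \<psi>"
  shows "F x0 - F x \<le> gap"
proof -
  have le: "opt_value f \<psi> \<le> ereal (F z)" if "z \<in> edom \<psi>" for z
    unfolding opt_value_def using INF_lower[OF that, of "objective f \<psi>"] objective_eq[OF that] by simp
  \<comment> \<open>The optimal value is finite, bounded below by assumption and above by the value
    at \<open>x0\<close>, so \<open>real_of_ereal\<close> in \<open>gap\<close> is faithful.\<close>
  obtain r where "opt_value f \<psi> = ereal r"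
    using bounded le[OF x0] by (cases "opt_value f \<psi>") auto
  then show ?thesis using le[OF assms] objective_eq[OF x0] by (simp add: gap_def)
qed

lemma start: "outer_index (run 0) = 0" "inner_index (run 0) = 0" "base_point (run 0) = x0" "tau (run 0) = \<tau>0"
  using run by (simp_all add: zero_order_CNM_def)

lemma call:
  "zero_order_cubic_steps f \<psi> (base_point (run c))
     (fd_hessian f (hess_stepsize CARD('n) m \<epsilon> (tau (run c)) (inner_index (run c))) (base_point (run c)))
     (reg_param m (tau (run c)) (inner_index (run c))) m \<epsilon>
     (iterates (run c)) (num_steps (run c)) (result (run c))"
  using run by (simp add: zero_order_CNM_def Let_def)

lemma halt:
  assumes "result (run c) = Halt"
  shows "outer_index (run (Suc c)) = outer_index (run c)" "inner_index (run (Suc c)) = inner_index (run c) + 1"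
    "base_point (run (Suc c)) = base_point (run c)" "tau (run (Suc c)) = tau (run c)"
  using run assms by (auto simp: zero_order_CNM_def Let_def dest!: spec[of _ c])

lemma success:
  assumes "result (run c) = Success"
  shows "outer_index (run (Suc c)) = outer_index (run c) + 1" "inner_index (run (Suc c)) = 0"
    "base_point (run (Suc c)) = iterates (run c) (num_steps (run c))"
    "tau (run (Suc c)) = max \<tau>0 (2 powr (real (inner_index (run c)) - 1) * tau (run c))"
  using run assms by (auto simp: zero_order_CNM_def Let_def dest!: spec[of _ c])

lemma outer_index_mono: "c \<le> d \<Longrightarrow> outer_index (run c) \<le> outer_index (run d)"
proof (induction d rule: dec_induct)
  case (step d)
  then show ?case using halt(1)[of d] success(1)[of d] by (cases "result (run d)") auto
qed simp

text \<open>If \<open>L \<le> 2^l * \<tau>\<close>, then \<open>call_decrease\<close> proves the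
  very test whose failure caused the halt. The rejected point is the last iterate, so
  \<open>\<not> hits c\<close> covers it too.\<close>

lemma halt_small_regularization:
  assumes "result (run c) = Halt" "\<not> hits c" "base_point (run c) \<in> edom \<psi>" "tau (run c) > 0"
    and le_Mx: "2 ^ inner_index (run c) * tau (run c) \<le> 2 * Mx"
  shows "2 ^ inner_index (run c) * tau (run c) < L"
proof (rule ccontr)
  let ?\<tau> = "tau (run c)" and ?l = "inner_index (run c)" and ?y = "iterates (run c)"
  let ?\<sigma> = "reg_param m ?\<tau> ?l"
  assume "\<not> ?thesis"
  then have L_le: "L \<le> 2 ^ ?l * ?\<tau>" by simp
  note zs = call[of c, unfolded zero_order_cubic_steps_def assms(1) outcome.case]
  then obtain t where t: "num_steps (run c) = t + 1" "\<not> sufficient_decrease f \<psi> ?\<sigma> \<epsilon> ?y t" by auto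
  have y0: "?y 0 = base_point (run c)" using zs by simp
  have "sufficient_decrease f \<psi> ?\<sigma> \<epsilon> ?y t"
    by (rule call_decrease[OF assms(4) \<epsilon> m _ L_le le_Mx])
      (use zs t assms(2,3) y0 in \<open>auto simp: hits_def\<close>)
  with t show False by simp
qed

text \<open>The last test of the call, at index \<open>m - 1\<close>, already compares the returned
  point with the base point.\<close>

lemma success_decrease:
  assumes "result (run c) = Success" "base_point (run c) \<in> edom \<psi>" "tau (run c) > 0"
    and le_Mx: "2 ^ inner_index (run c) * tau (run c) \<le> 2 * Mx"
  shows "base_point (run (Suc c)) \<in> edom \<psi>"
    and "1 \<le> rate * (F (base_point (run c)) - F (base_point (run (Suc c))))"
proof -
  let ?\<tau> = "tau (run c)" and ?l = "inner_index (run c)" and ?y = "iterates (run c)"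
  let ?\<sigma> = "reg_param m ?\<tau> ?l"
  note zs = call[of c, unfolded zero_order_cubic_steps_def assms(1) outcome.case]
  note \<sigma> = reg_param_bounds(3)[OF assms(3) m, of ?l]
  have N: "num_steps (run c) = m" and y0: "?y 0 = base_point (run c)" using zs by simp_all
  have m': "m - 1 < m" "m - 1 + 1 = m" using m by simp_all
  from zs N m' have "?y m \<in> edom \<psi>" by (metis approx_cubic_step_def)
  then show dom: "base_point (run (Suc c)) \<in> edom \<psi>" by (simp add: success(3)[OF assms(1)] N)
  have "sufficient_decrease f \<psi> ?\<sigma> \<epsilon> ?y (m - 1)" using zs m' by blast
  then have "\<epsilon> powr (3/2) / (384 * sqrt ?\<sigma>) * real m \<le> F (base_point (run c)) - F (base_point (run (Suc c)))"
    unfolding sufficient_decrease_def m' y0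
    using objective_eq[OF assms(2)] objective_eq[OF dom] by (simp add: success(3)[OF assms(1)] N)
  then have "rate * (\<epsilon> powr (3/2) / (384 * sqrt ?\<sigma>) * real m)
      \<le> rate * (F (base_point (run c)) - F (base_point (run (Suc c))))"
    using rate_pos by (intro mult_left_mono) auto
  moreover have "1 \<le> rate * (\<epsilon> powr (3/2) / (384 * sqrt ?\<sigma>) * real m)"
  proof -
    \<comment> \<open>The square root of the largest \<sigma> compatible with \<open>le_Mx\<close>;
      the square of \<open>2 powr (5/2)\<close> is \<open>2^4 * 2\<close>.\<close>
    let ?S = "2 powr (5/2) * (2/3) powr (1/6) * sqrt Mx * sqrt (real m)"
    have "?\<sigma> \<le> 2 ^ 4 * (2/3) powr (1/3) * (2 * Mx) * real m"
      unfolding reg_param_def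
      by (intro mult_right_mono[OF mult_left_mono[OF le_Mx]], simp_all)
    also have "\<dots> = ?S\<^sup>2"
    proof -
      have "(2 powr (5/2))\<^sup>2 = (32::real)" "((2/3) powr (1/6))\<^sup>2 = (2/3::real) powr (1/3)"
        by (simp_all add: powr_powr flip: powr_numeral)
      then show ?thesis using Mx_pos by (simp add: power_mult_distrib)
    qed
    finally have "sqrt ?\<sigma> \<le> ?S"
      using Mx_pos by (intro real_le_lsqrt) auto
    then have "1 \<le> ?S / sqrt ?\<sigma>" using \<sigma> by (simp add: pos_le_divide_eq)
    moreover have "\<epsilon> powr (-3/2) * \<epsilon> powr (3/2) = 1"
      using \<epsilon> by (simp add: powr_add[symmetric])
    moreover have "rate * (\<epsilon> powr (3/2) / (384 * sqrt ?\<sigma>) * real m)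
        = ?S / sqrt ?\<sigma> * (\<epsilon> powr (-3/2) * \<epsilon> powr (3/2)) * (real m / (sqrt (real m) * sqrt (real m)))"
      unfolding rate_def using m by (simp add: field_simps del: real_sqrt_mult_self)
    ultimately show ?thesis using m by simp
  qed
  ultimately show "1 \<le> rate * (F (base_point (run c)) - F (base_point (run (Suc c))))" by linarith
qed

text \<open>
  The difference \<open>c - l\<close> is the position of the first call of the current outer iteration, which
  by the last clause started after at most \<open>2 k + log\<^sub>2 (\<tau>\<^sub>k / \<tau>\<^sub>0)\<close> calls.
\<close>

definition run_invariant :: "nat \<Rightarrow> bool" where
  "run_invariant c \<longleftrightarrow>
     (let k = outer_index (run c); l = inner_index (run c); x = base_point (run c); \<tau> = tau (run c) in
       \<tau>0 \<le> \<tau> \<and> \<tau> \<le> Mx \<and> 2 ^ l * \<tau> \<le> 2 * Mx \<and> x \<in> edom \<psi> \<and>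
       real k \<le> rate * (F x0 - F x) \<and>
       l \<le> c \<and> (\<forall>d. c - l \<le> d \<and> d \<le> c \<longrightarrow> outer_index (run d) = k) \<and>
       real (c - l) \<le> 2 * real k + log 2 (\<tau> / \<tau>0))"

lemma run_invariantD:
  assumes "run_invariant c"
  shows "\<tau>0 \<le> tau (run c)" "tau (run c) \<le> Mx" "2 ^ inner_index (run c) * tau (run c) \<le> 2 * Mx"
    and "base_point (run c) \<in> edom \<psi>"
    and "real (outer_index (run c)) \<le> rate * (F x0 - F (base_point (run c)))"
    and "inner_index (run c) \<le> c"
    and "\<And>d. c - inner_index (run c) \<le> d \<Longrightarrow> d \<le> c \<Longrightarrow> outer_index (run d) = outer_index (run c)"
    and "real (c - inner_index (run c)) \<le> 2 * real (outer_index (run c)) + log 2 (tau (run c) / \<tau>0)"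
  using assms unfolding run_invariant_def Let_def by blast+

lemma run_invariant:
  assumes "\<And>d. d < c \<Longrightarrow> \<not> hits d"
  shows "run_invariant c"
  using assms
proof (induction c)
  case 0
  then show ?case using x0 \<tau>0 Mx_pos by (simp add: run_invariant_def start Let_def max_def)
next
  case (Suc c)
  let ?k = "outer_index (run c)" and ?l = "inner_index (run c)" and ?x = "base_point (run c)" and ?\<tau> = "tau (run c)"
  have no_hit: "\<not> hits c" and "run_invariant c"
    using Suc.IH Suc.prems by (simp_all add: less_SucI)
  note inv = run_invariantD[OF this(2)]
  note \<tau> = inv(1,2) and le_Mx = inv(3) and x = inv(4) and k = inv(5) and l = inv(6)
    and same = inv(7) and first = inv(8)
  have pos: "?\<tau> > 0" using \<tau> \<tau>0 by simp
  show ?case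
  proof (cases "result (run c)")
    case Halt
    have "2 ^ ?l * ?\<tau> < L"
      by (rule halt_small_regularization[OF Halt no_hit x pos le_Mx])
    \<comment> \<open>The halted value lies below \<open>L\<close>, so doubling it stays within
      \<open>2 * Mx\<close>. The position of the first call is unchanged, because \<open>c\<close>
      and the inner index both grow by one.\<close>
    then have next_le: "2 ^ Suc ?l * ?\<tau> \<le> 2 * Mx" by simp
    have next_same: "outer_index (run d) = ?k" if "c - ?l \<le> d" "d \<le> Suc c" for d
      using same[of d] that halt(1)[OF Halt] by (cases "d = Suc c") auto
    show ?thesis
      unfolding run_invariant_def Let_def halt[OF Halt] Suc_eq_plus1[symmetric] diff_Suc_Suc Suc_le_mono
      by (intro conjI allI impI \<tau> x k l first next_le, elim conjE, rule next_same)
  next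
    case Success
    let ?\<tau>' = "tau (run (Suc c))" and ?x' = "base_point (run (Suc c))"
    note dec = success_decrease[OF Success x pos le_Mx]
    have scaled: "2 powr (real ?l - 1) * ?\<tau> = 2 ^ ?l * ?\<tau> / 2"
      by (simp add: powr_diff powr_realpow)
    have \<tau>': "\<tau>0 \<le> ?\<tau>'" "?\<tau>' \<le> Mx" "2 ^ ?l * ?\<tau> / 2 \<le> ?\<tau>'"
      using le_Mx unfolding success(4)[OF Success] scaled by auto
    \<comment> \<open>A finished outer iteration took \<open>l + 1 = 2 + (l - 1)\<close> calls: the
      2 is charged to the outer counter, and \<open>l - 1\<close> to the growth of the logarithm of
      \<tau>.\<close>
    have "log 2 (2 ^ ?l * ?\<tau> / 2 / \<tau>0) \<le> log 2 (?\<tau>' / \<tau>0)"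
      using \<tau>'(3) \<tau>0 pos by (intro log_mono divide_right_mono) auto
    moreover have "log 2 (2 ^ ?l * ?\<tau> / 2 / \<tau>0) = real ?l - 1 + log 2 (?\<tau> / \<tau>0)"
      using \<tau>0 pos by (simp add: log_mult log_divide log_nat_power)
    ultimately have log: "real ?l - 1 + log 2 (?\<tau> / \<tau>0) \<le> log 2 (?\<tau>' / \<tau>0)" by simp
    have next_first: "real (Suc c) \<le> 2 * real (?k + 1) + log 2 (?\<tau>' / \<tau>0)"
      using first log l by (simp add: of_nat_diff)
    have next_k: "real (?k + 1) \<le> rate * (F x0 - F ?x')"
      using k dec(2) by (simp add: algebra_simps)
    have next_same: "outer_index (run d) = ?k + 1" if "Suc c \<le> d" "d \<le> Suc c" for d
      using le_antisym[OF that] success(1)[OF Success] by simp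
    have next_le: "?\<tau>' \<le> 2 * Mx" using \<tau>'(2) Mx_pos by linarith
    show ?thesis
      unfolding run_invariant_def Let_def success(1,2)[OF Success] diff_zero power_0 mult_1_left
      by (intro conjI allI impI \<tau>'(1,2) le0 dec(1) next_first next_k next_le, elim conjE, rule next_same)
  qed
qed

section \<open>The first hit and the count of calls and evaluations\<close>

lemma gap_nonneg: "gap \<ge> 0"
  using decrease_le_gap[OF x0] by simp

lemma iterations_le:
  assumes "run_invariant c"
  shows "real (outer_index (run c)) \<le> rate * gap"
proof -
  note inv = run_invariantD[OF assms]
  have "rate * (F x0 - F (base_point (run c))) \<le> rate * gap"
    using decrease_le_gap[OF inv(4)] rate_pos by (intro mult_left_mono) auto
  with inv(5) show ?thesis by linarith
qed

lemma calls_before_le: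
  assumes "run_invariant c"
  shows "real (c - inner_index (run c)) \<le> 2 * (rate * gap) + log 2 (Mx / \<tau>0)"
proof -
  note inv = run_invariantD[OF assms]
  have "log 2 (tau (run c) / \<tau>0) \<le> log 2 (Mx / \<tau>0)"
    using inv(1,2) \<tau>0 by (intro log_mono divide_right_mono) auto
  then show ?thesis using iterations_le[OF assms] inv(8) by linarith
qed

text \<open>Without a hit the invariant would hold forever. It bounds the position of the first call
  of the current outer iteration, and also the inner index, since
  \<open>l * \<tau>0 \<le> 2^l * \<tau> \<le> 2 * Mx\<close>; so the call number would be
  bounded.\<close>

lemma ex_hits: "\<exists>c. hits c"
proof (rule ccontr)
  assume "\<not> ?thesis"
  then have inv: "run_invariant c" for c by (intro run_invariant) auto
  have "real c \<le> 2 * (rate * gap) + log 2 (Mx / \<tau>0) + 2 * Mx / \<tau>0" for c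
  proof -
    let ?l = "inner_index (run c)"
    note * = run_invariantD(3,1,6)[OF inv[of c]]
    have "real ?l * \<tau>0 \<le> 2 ^ ?l * tau (run c)"
      using *(2) \<tau>0 of_nat_less_two_power[of ?l, where 'a = real] by (intro mult_mono) auto
    with *(1) have "real ?l \<le> 2 * Mx / \<tau>0" using \<tau>0 by (simp add: pos_le_divide_eq)
    moreover have "real c = real (c - ?l) + real ?l" using *(3) by simp
    ultimately show ?thesis using calls_before_le[OF inv[of c]] by linarith
  qed
  then show False by (meson reals_Archimedean2 not_less)
qed

definition first_hit :: nat where
  "first_hit = (LEAST c. hits c)"

lemma hits_first_hit: "hits first_hit"
  unfolding first_hit_def using ex_hits by (metis LeastI)

lemma invariant_first_hit: "run_invariant first_hit"
  by (rule run_invariant) (use not_less_Least in \<open>auto simp: first_hit_def\<close>)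

text \<open>Outer indices are nondecreasing along the run, so the first call with a hit attains the
  infimum.\<close>

lemma hitting_iteration_eq:
  "hitting_iteration f \<psi> L \<tau>0 \<epsilon> m run = enat (outer_index (run first_hit))"
proof -
  let ?A = "{enat k | k. \<exists>c t. outer_index (run c) = k \<and> t \<le> num_steps (run c) \<and>
            approx_second_order_point f \<psi> L \<tau>0 \<epsilon> m (iterates (run c) t)}"
  have A: "?A = {enat (outer_index (run c)) | c. hits c}" by (auto simp: hits_def)
  have "Inf {enat (outer_index (run c)) | c. hits c} = enat (outer_index (run first_hit))"
  proof (rule antisym)
    show "Inf {enat (outer_index (run c)) | c. hits c} \<le> enat (outer_index (run first_hit))"
      using hits_first_hit by (intro Inf_lower) auto
    show "enat (outer_index (run first_hit)) \<le> Inf {enat (outer_index (run c)) | c. hits c}"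
    proof (rule Inf_greatest, clarify)
      fix c assume "hits c"
      then have "first_hit \<le> c" by (simp add: first_hit_def Least_le)
      then show "enat (outer_index (run first_hit)) \<le> enat (outer_index (run c))"
        using outer_index_mono by simp
    qed
  qed
  then show ?thesis unfolding hitting_iteration_def A .
qed

lemma call_evaluations_le:
  "call_evaluations (run c) \<le> 4 * CARD('n)\<^sup>2 + 6 * m * CARD('n)"
proof -
  have "num_steps (run c) \<le> m" using call[of c] by (simp add: zero_order_cubic_steps_def)
  moreover have "2 * CARD('n) + 4 \<le> 6 * CARD('n)" by (simp add: Suc_leI)
  ultimately have "num_steps (run c) * (2 * CARD('n) + 4) \<le> m * (6 * CARD('n))" by (rule mult_le_mono)
  then show ?thesis by (simp add: call_evaluations_def)
qed

lemma evaluations_le: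
  "evaluations_before (hitting_iteration f \<psi> L \<tau>0 \<epsilon> m run) run
    \<le> ereal ((2 * (rate * gap) + log 2 (Mx / \<tau>0)) * (4 * (real CARD('n))\<^sup>2 + 6 * real m * real CARD('n)))"
proof -
  let ?K = "outer_index (run first_hit)" and ?N = "first_hit - inner_index (run first_hit)"
  let ?e = "4 * (real CARD('n))\<^sup>2 + 6 * real m * real CARD('n)"
  let ?g = "\<lambda>c. if enat (outer_index (run c)) < enat ?K then ereal (real (call_evaluations (run c))) else 0"
  have e: "real (call_evaluations (run c)) \<le> ?e" for c
    using of_nat_mono[OF call_evaluations_le[of c], where 'a = real] by simp
  \<comment> \<open>Calls from \<open>?N\<close> up to \<open>first_hit\<close> belong to iteration
    \<open>?K\<close>, and later ones to \<open>?K\<close> or beyond. The series therefore reduces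
    to its first \<open>?N\<close> terms.\<close>
  have before: "c < ?N" if "outer_index (run c) < ?K" for c
  proof (rule ccontr)
    assume "\<not> c < ?N"
    moreover have "c < first_hit"
      using that outer_index_mono[of first_hit c] by (simp add: not_le[symmetric]) (metis nat_le_linear not_le)
    ultimately have "outer_index (run c) = ?K"
      using run_invariantD(7)[OF invariant_first_hit, of c] by simp
    with that show False by simp
  qed
  have "evaluations_before (enat ?K) run = (\<Sum>c<?N. ?g c)"
    unfolding evaluations_before_def using before by (intro suminf_finite) auto
  also have "\<dots> \<le> (\<Sum>c<?N. ereal ?e)"
    using e by (intro sum_mono) auto
  also have "\<dots> = ereal (real ?N * ?e)" by simp
  also have "\<dots> \<le> ereal ((2 * (rate * gap) + log 2 (Mx / \<tau>0)) * ?e)"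
    using calls_before_le[OF invariant_first_hit] by (auto intro!: mult_right_mono)
  finally show ?thesis by (simp add: hitting_iteration_eq)
qed

end

theorem theorem5p7:
  fixes f :: "real^'n \<Rightarrow> real" and \<psi> :: "real^'n \<Rightarrow> ereal"
    and L \<tau>0 \<epsilon> :: real and m :: nat and x0 :: "real^'n"
    and run :: "nat \<Rightarrow> 'n call"
  defines "n \<equiv> real CARD('n)"
    and "\<Delta> \<equiv> real_of_ereal (objective f \<psi> x0) - real_of_ereal (opt_value f \<psi>)"
    and "T \<equiv> hitting_iteration f \<psi> L \<tau>0 \<epsilon> m run"
  assumes "twice_continuously_differentiable f"
    and "proper_closed_convex \<psi>"
    and "\<And>x. x \<in> edom \<psi> \<Longrightarrow> twice_differentiable_at \<psi> x"
    and "opt_value f \<psi> > -\<infinity>"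
    and "L \<ge> 0"
    and "\<And>x y. spectral_norm (hessian f y - hessian f x) \<le> L * norm (y - x)"
    and "x0 \<in> edom \<psi>" and "\<tau>0 > 0" and "\<epsilon> > 0" and "m \<ge> 1"
    and "zero_order_CNM f \<psi> x0 \<tau>0 \<epsilon> m run"
  shows "ereal_of_enat T \<le>
           ereal (384 * 2 powr (5/2) * (2/3) powr (1/6) * sqrt (max \<tau>0 L) * \<Delta> / sqrt (real m)
                    * \<epsilon> powr (-3/2))
       \<and> evaluations_before T run \<le>
           ereal (evaluation_constant *
             ((real m * n + n\<^sup>2) / sqrt (real m) * sqrt (max \<tau>0 L) * \<Delta> * \<epsilon> powr (-3/2)
              + (real m * n + 3 * n\<^sup>2) * log 2 (max \<tau>0 L / \<tau>0)))"
proof -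
  interpret cnm_run f L \<psi> x0 \<tau>0 \<epsilon> m run
    by unfold_locales (use assms in auto)
  have \<Delta>: "\<Delta> = gap" by (simp add: \<Delta>_def gap_def)
  have "ereal_of_enat T \<le> ereal (rate * \<Delta>)"
    using iterations_le[OF invariant_first_hit] by (simp add: T_def hitting_iteration_eq \<Delta>)
  moreover have "rate * \<Delta> = 384 * 2 powr (5/2) * (2/3) powr (1/6) * sqrt Mx * \<Delta> / sqrt (real m) * \<epsilon> powr (-3/2)"
    by (simp add: rate_def)
  moreover have "(2 * (rate * gap) + log 2 (Mx / \<tau>0)) * (4 * n\<^sup>2 + 6 * real m * n)
      \<le> evaluation_constant * ((real m * n + n\<^sup>2) / sqrt (real m) * sqrt Mx * \<Delta> * \<epsilon> powr (-3/2)
              + (real m * n + 3 * n\<^sup>2) * log 2 (Mx / \<tau>0))"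
  proof -
    define Z where "Z = sqrt Mx * gap / sqrt (real m) * \<epsilon> powr (-3/2)"
    define \<Lambda> where "\<Lambda> = log 2 (Mx / \<tau>0)"
    have Z: "Z \<ge> 0" using gap_nonneg Mx_pos by (simp add: Z_def)
    have \<Lambda>: "\<Lambda> \<ge> 0" using \<open>\<tau>0 > 0\<close> by (simp add: \<Lambda>_def)
    have n: "n \<ge> 0" by (simp add: n_def)
    \<comment> \<open>Numerically \<open>5.66^2 > 32\<close>, which yields
      \<open>384 * 5.66 < 2174\<close> below.\<close>
    have "2 powr (5/2) \<le> (566/100 :: real)"
    proof (rule power2_le_imp_le)
      show "(2 powr (5/2))\<^sup>2 \<le> (566/100 :: real)\<^sup>2"
        by (simp add: powr_powr power_divide flip: powr_numeral)
    qed simp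
    moreover have "(2/3) powr (1/6) \<le> (1::real)"
      by (rule powr_le1) auto
    ultimately have "2 powr (5/2) * (2/3) powr (1/6) \<le> (566/100 * 1 :: real)"
      by (intro mult_mono) auto
    then have "384 * (2 powr (5/2) * (2/3) powr (1/6)) * Z \<le> 2174 * Z"
      using Z by (intro mult_right_mono) auto
    moreover have "rate * gap = 384 * (2 powr (5/2) * (2/3) powr (1/6)) * Z"
      by (simp add: rate_def Z_def)
    ultimately have "2 * (rate * gap) + \<Lambda> \<le> 4348 * Z + \<Lambda>" by simp
    \<comment> \<open>The factor 6 covers both \<open>4 * n^2\<close> and \<open>6 * m * n\<close>,
      and \<open>6 * 4348 = 26088\<close> is below the fixed constant \<open>2^15\<close>.\<close>
    then have "(2 * (rate * gap) + \<Lambda>) * (4 * n\<^sup>2 + 6 * real m * n)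
        \<le> (4348 * Z + \<Lambda>) * (6 * (real m * n + n\<^sup>2))"
      using n Z \<Lambda> by (intro mult_mono) auto
    also have "\<dots> = 26088 * ((real m * n + n\<^sup>2) * Z) + 6 * ((real m * n + n\<^sup>2) * \<Lambda>)"
      by (simp add: algebra_simps)
    also have "\<dots> \<le> 32768 * ((real m * n + n\<^sup>2) * Z) + 32768 * ((real m * n + 3 * n\<^sup>2) * \<Lambda>)"
      using n Z \<Lambda> by (intro add_mono mult_mono) auto
    also have "\<dots> = evaluation_constant * ((real m * n + n\<^sup>2) / sqrt (real m) * sqrt Mx * \<Delta> * \<epsilon> powr (-3/2)
              + (real m * n + 3 * n\<^sup>2) * \<Lambda>)"
      by (simp add: evaluation_constant_def Z_def \<Delta> algebra_simps)
    finally show ?thesis by (simp only: \<Lambda>_def)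
  qed
  ultimately show ?thesis
    using evaluations_le[folded T_def n_def] by (auto intro: order_trans)
qed

end
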